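(* Let $(H,\Delta,\epsilon,\Phi,S,\alpha,\beta)$ be a quasi-triangular quasi-Hopf algebra with bijective antipode and $R$-matrix $\mathcal{R}$. Then there exists a unique invertible $u\in H$ such that $$S(a)=uS^{-1}(a)u^{-1},\ \text{ or equivalently }\ S^2(a)=uau^{-1},\qquad\forall a\in H,$$ and $$uS^{-1}(\alpha)=\alpha_{\mathcal{R}},\qquad \beta_{\mathcal{R}}u=S^{-1}(\beta).$$ Explicitly, $$u=\sum S(Y_\nu\beta S(Z_\nu))\alpha_{\mathcal{R}}X_\nu=\sum S(\bar Z_\nu)\alpha_{\mathcal{R}}\bar Y_\nu S^{-1}(\beta)S^{-1}(\bar X_\nu),$$ $$u^{-1}=\sum Z_\nu\beta_{\mathcal{R}}S(S(X_\nu)\alpha Y_\nu)=\sum S^{-1}(\bar Z_\nu)S^{-1}(\alpha)\bar Y_\nu\beta_{\mathcal{R}}S(\bar X_\nu).$$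
   Context: A quasi-bialgebra $(H,\Delta,\epsilon,\Phi)$ over a field $k$ is a unital associative $k$-algebra $H$ with algebra homomorphisms $\epsilon:H\to k$, $\Delta:H\to H\otimes H$ and an invertible $\Phi\in H\otimes H\otimes H$ such that (with $1$ also denoting the identity map) $(1\otimes\Delta)\Delta(a)=\Phi^{-1}(\Delta\otimes 1)\Delta(a)\Phi$ for all $a\in H$; $(\Delta\otimes 1\otimes 1)\Phi\cdot(1\otimes 1\otimes\Delta)\Phi=(\Phi\otimes 1)\cdot(1\otimes\Delta\otimes 1)\Phi\cdot(1\otimes\Phi)$; $(\epsilon\otimes 1)\Delta=1=(1\otimes\epsilon)\Delta$; $(1\otimes\epsilon\otimes 1)\Phi=1$. Write $\Phi=\sum_\nu X_\nu\otimes Y_\nu\otimes Z_\nu$, $\Phi^{-1}=\sum_\nu\bar X_\nu\otimes\bar Y_\nu\otimes\bar Z_\nu$, $\Delta(a)=\sum a_{(1)}\otimes a_{(2)}$. A quasi-Hopf algebra $(H,\Delta,\epsilon,\Phi,S,\alpha,\beta)$ is a quasi-bialgebra with an algebra anti-homomorphism $S:H\to H$ (assumed bijective) and $\alpha,\beta\in H$ such that $\sum S(X_\nu)\alpha Y_\nu\beta S(Z_\nu)=1=\sum\bar X_\nu\beta S(\bar Y_\nu)\alpha\bar Z_\nu$ and $\sum S(a_{(1)})\alpha a_{(2)}=\epsilon(a)\alpha$, $\sum a_{(1)}\beta S(a_{(2)})=\epsilon(a)\beta$ for all $a\in H$. It is quasi-triangular if there is an invertible $\mathcal{R}=\sum e_i\otimes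 e^i\in H\otimes H$ (the $R$-matrix) with $\Delta^T(a)\mathcal{R}=\mathcal{R}\Delta(a)$ for all $a$, $(\Delta\otimes 1)\mathcal{R}=\Phi_{231}^{-1}\mathcal{R}_{13}\Phi_{132}\mathcal{R}_{23}\Phi_{123}^{-1}$, $(1\otimes\Delta)\mathcal{R}=\Phi_{312}\mathcal{R}_{13}\Phi_{213}^{-1}\mathcal{R}_{12}\Phi_{123}$. Here $\Delta^T=T\circ\Delta$ with $T$ the flip, $\mathcal{R}_{12}=\sum e_i\otimes e^i\otimes 1$, $\mathcal{R}_{13}=\sum e_i\otimes 1\otimes e^i$, $\mathcal{R}_{23}=\sum 1\otimes e_i\otimes e^i$, and $\Phi_{123}=\Phi$, $\Phi_{132}=\sum X_\nu\otimes Z_\nu\otimes Y_\nu$, $\Phi_{213}=\sum Y_\nu\otimes X_\nu\otimes Z_\nu$, $\Phi_{231}=\sum Y_\nu\otimes Z_\nu\otimes X_\nu$, $\Phi_{312}=\sum Z_\nu\otimes X_\nu\otimes Y_\nu$. With $\mathcal{R}^{-1}=\sum\bar e_i\otimes\bar e^i$, set $\alpha_{\mathcal{R}}=\sum S(\bar e_i)\alpha\bar e^i$ and $\beta_{\mathcal{R}}=\sum e_i\beta S(e^i)$. *)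

theory Defs
  imports Complex_Main "HOL-Library.Poly_Mapping"
begin

definition ring_unit :: "'a::ring_1 \<Rightarrow> bool" where
  "ring_unit u \<longleftrightarrow> (\<exists>v. u * v = 1 \<and> v * u = 1)"

definition ring_inv :: "'a::ring_1 \<Rightarrow> 'a" where
  "ring_inv u = (THE v. u * v = 1 \<and> v * u = 1)"

text \<open>
  Formal linear combinations of lists: the free vector space on the tuples over an algebra.
  The list [x, y, z] stands for the pure tensor of x, y and z.
\<close>

type_synonym ('a, 'k) formal = "'a list \<Rightarrow>\<^sub>0 'k"

definition fscale :: "'k::field \<Rightarrow> ('a, 'k) formal \<Rightarrow> ('a, 'k) formal" where
  "fscale c p = Poly_Mapping.map ((*) c) p"

definition pure :: "'a list \<Rightarrow> ('a, 'k::field) formal" where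
  "pure xs = Poly_Mapping.single xs 1"

definition formals :: "nat \<Rightarrow> ('a, 'k::field) formal set" where
  "formals n = {p. \<forall>xs\<in>Poly_Mapping.keys p. length xs = n}"

lemma lookup_fscale: "Poly_Mapping.lookup (fscale c p) xs = c * Poly_Mapping.lookup p xs"
  by (simp add: fscale_def Poly_Mapping.map.rep_eq when_def)

interpretation formal: vector_space fscale
  by unfold_locales
    (auto intro!: poly_mapping_eqI simp: lookup_fscale lookup_add algebra_simps)

text \<open>Linear extension of a function given on pure tensors, with values in a vector space.\<close>

definition linext ::
    "('k::field \<Rightarrow> 'v::comm_monoid_add \<Rightarrow> 'v) \<Rightarrow> ('a list \<Rightarrow> 'v) \<Rightarrow> ('a, 'k) formal \<Rightarrow> 'v" where
  "linext sc g p = (\<Sum>xs\<in>Poly_Mapping.keys p. sc (Poly_Mapping.lookup p xs) (g xs))"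

text \<open>
  Unital associative algebras over a field; class \<open>ring_1\<close> includes \<open>0 \<noteq> 1\<close>, which
  is no restriction in the presence of a unital counit.
\<close>

locale k_algebra = vector_space scale
  for scale :: "'k::field \<Rightarrow> 'a::ring_1 \<Rightarrow> 'a" (infixr "*s" 75) +
  assumes scale_mult_left: "(c *s x) * y = c *s (x * y)"
    and scale_mult_right: "x * (c *s y) = c *s (x * y)"
begin

definition multilinear_rels :: "nat \<Rightarrow> ('a, 'k) formal set" where
  "multilinear_rels n =
     {pure (xs @ (x + y) # ys) - pure (xs @ x # ys) - pure (xs @ y # ys) | xs x y ys.
        length xs + length ys + 1 = n} \<union>
     {pure (xs @ (c *s x) # ys) - fscale c (pure (xs @ x # ys)) | xs c x ys.
        length xs + length ys + 1 = n}"

text \<open>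
  The n-fold tensor power of the algebra is the quotient of \<open>formals n\<close> by the span
  of the multilinearity relations; its elements are the cosets \<open>tclass n p\<close>.
\<close>

definition tclass :: "nat \<Rightarrow> ('a, 'k) formal \<Rightarrow> ('a, 'k) formal set" where
  "tclass n p = {q \<in> formals n. q - p \<in> formal.span (multilinear_rels n)}"

definition tpower :: "nat \<Rightarrow> ('a, 'k) formal set set" where
  "tpower n = tclass n ` formals n"

text \<open>
  \<open>expr X\<close> is an arbitrary expression of the tensor X as a linear combination of pure
  tensors. It is only used to define maps induced by multilinear ones, whose values do not
  depend on that choice.
\<close>

definition expr :: "('a, 'k) formal set \<Rightarrow> ('a, 'k) formal" where
  "expr X = (SOME p. p \<in> X)"

text \<open>
  \<open>tmap n g X\<close> applies the linear map into the n-th tensor power induced by the multilinear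
  map g; for a multilinear F with values in the algebra itself, \<open>contract2 F X\<close> is the sum of
  the values F x y, where X is the sum of the pure tensors of x and y, and similarly for
  \<open>contract3\<close>.
\<close>

definition tmap ::
    "nat \<Rightarrow> ('a list \<Rightarrow> ('a, 'k) formal) \<Rightarrow> ('a, 'k) formal set \<Rightarrow> ('a, 'k) formal set" where
  "tmap n g X = tclass n (linext fscale g (expr X))"

definition contract2 :: "('a \<Rightarrow> 'a \<Rightarrow> 'a) \<Rightarrow> ('a, 'k) formal set \<Rightarrow> 'a" where
  "contract2 F X = linext scale (\<lambda>xs. F (xs ! 0) (xs ! 1)) (expr X)"

definition contract3 :: "('a \<Rightarrow> 'a \<Rightarrow> 'a \<Rightarrow> 'a) \<Rightarrow> ('a, 'k) formal set \<Rightarrow> 'a" where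
  "contract3 F X = linext scale (\<lambda>xs. F (xs ! 0) (xs ! 1) (xs ! 2)) (expr X)"

definition tplus :: "nat \<Rightarrow> ('a, 'k) formal set \<Rightarrow> ('a, 'k) formal set \<Rightarrow> ('a, 'k) formal set" where
  "tplus n X Y = tclass n (expr X + expr Y)"

definition tscale :: "nat \<Rightarrow> 'k \<Rightarrow> ('a, 'k) formal set \<Rightarrow> ('a, 'k) formal set" where
  "tscale n c X = tclass n (fscale c (expr X))"

definition tmult :: "('a, 'k) formal set \<Rightarrow> nat \<Rightarrow> ('a, 'k) formal set \<Rightarrow> ('a, 'k) formal set"
    ("(_ \<odot>\<^bsub>_\<^esub> _)" [70, 0, 71] 70) where
  "X \<odot>\<^bsub>n\<^esub> Y = tmap n (\<lambda>xs. linext fscale (\<lambda>ys. pure (map2 (*) xs ys)) (expr Y)) X"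

definition tone :: "nat \<Rightarrow> ('a, 'k) formal set" where
  "tone n = tclass n (pure (replicate n 1))"

definition is_tinv :: "nat \<Rightarrow> ('a, 'k) formal set \<Rightarrow> ('a, 'k) formal set \<Rightarrow> bool" where
  "is_tinv n X Y \<longleftrightarrow> Y \<in> tpower n \<and> X \<odot>\<^bsub>n\<^esub> Y = tone n \<and> Y \<odot>\<^bsub>n\<^esub> X = tone n"

definition tunit :: "nat \<Rightarrow> ('a, 'k) formal set \<Rightarrow> bool" where
  "tunit n X \<longleftrightarrow> X \<in> tpower n \<and> (\<exists>Y. is_tinv n X Y)"

definition tinv :: "nat \<Rightarrow> ('a, 'k) formal set \<Rightarrow> ('a, 'k) formal set" where
  "tinv n X = (THE Y. is_tinv n X Y)"

text \<open>
  \<open>map_leg D n i\<close> applies D to the i-th tensor factor (counting from 0), where D maps the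
  algebra to its tensor square; the result lies in the n-th tensor power.
\<close>

definition map_leg ::
    "('a \<Rightarrow> ('a, 'k) formal set) \<Rightarrow> nat \<Rightarrow> nat \<Rightarrow> ('a, 'k) formal set \<Rightarrow> ('a, 'k) formal set" where
  "map_leg D n i X =
     tmap n (\<lambda>xs. linext fscale (\<lambda>ds. pure (take i xs @ ds @ drop (Suc i) xs)) (expr (D (xs ! i)))) X"

end

locale quasi_bialgebra = k_algebra scale
  for scale :: "'k::field \<Rightarrow> 'a::ring_1 \<Rightarrow> 'a" (infixr "*s" 75) +
  fixes \<Delta> :: "'a \<Rightarrow> ('a, 'k) formal set"
    and \<epsilon> :: "'a \<Rightarrow> 'k"
    and \<Phi> :: "('a, 'k) formal set"
  assumes counit_linear: "Vector_Spaces.linear scale (*) \<epsilon>"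
    and counit_mult: "\<epsilon> (a * b) = \<epsilon> a * \<epsilon> b"
    and counit_one: "\<epsilon> 1 = 1"
    and comult_closed: "\<Delta> a \<in> tpower 2"
    and comult_add: "\<Delta> (a + b) = tplus 2 (\<Delta> a) (\<Delta> b)"
    and comult_scale: "\<Delta> (c *s a) = tscale 2 c (\<Delta> a)"
    and comult_mult: "\<Delta> (a * b) = \<Delta> a \<odot>\<^bsub>2\<^esub> \<Delta> b"
    and comult_one: "\<Delta> 1 = tone 2"
    and assoc_unit: "tunit 3 \<Phi>"
    and quasi_coassoc:
      "map_leg \<Delta> 3 1 (\<Delta> a) = tinv 3 \<Phi> \<odot>\<^bsub>3\<^esub> map_leg \<Delta> 3 0 (\<Delta> a) \<odot>\<^bsub>3\<^esub> \<Phi>"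
    and pentagon:
      "map_leg \<Delta> 4 0 \<Phi> \<odot>\<^bsub>4\<^esub> map_leg \<Delta> 4 2 \<Phi> =
       tmap 4 (\<lambda>xs. pure (xs @ [1])) \<Phi> \<odot>\<^bsub>4\<^esub> map_leg \<Delta> 4 1 \<Phi> \<odot>\<^bsub>4\<^esub> tmap 4 (\<lambda>xs. pure (1 # xs)) \<Phi>"
    and counit_left: "contract2 (\<lambda>x y. \<epsilon> x *s y) (\<Delta> a) = a"
    and counit_right: "contract2 (\<lambda>x y. \<epsilon> y *s x) (\<Delta> a) = a"
    and counit_assoc: "tmap 2 (\<lambda>xs. fscale (\<epsilon> (xs ! 1)) (pure [xs ! 0, xs ! 2])) \<Phi> = tone 2"

locale quasi_hopf_algebra = quasi_bialgebra scale \<Delta> \<epsilon> \<Phi>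
  for scale :: "'k::field \<Rightarrow> 'a::ring_1 \<Rightarrow> 'a" (infixr "*s" 75)
    and \<Delta> :: "'a \<Rightarrow> ('a, 'k) formal set"
    and \<epsilon> :: "'a \<Rightarrow> 'k"
    and \<Phi> :: "('a, 'k) formal set" +
  fixes S :: "'a \<Rightarrow> 'a"
    and \<alpha> :: 'a
    and \<beta> :: 'a
  assumes antipode_linear: "Vector_Spaces.linear scale scale S"
    and antipode_mult: "S (a * b) = S b * S a"
    and antipode_one: "S 1 = 1"
    and antipode_bij: "bij S"
    and antipode_assoc: "contract3 (\<lambda>x y z. S x * \<alpha> * y * \<beta> * S z) \<Phi> = 1"
    and antipode_assoc_inv: "contract3 (\<lambda>x y z. x * \<beta> * S y * \<alpha> * z) (tinv 3 \<Phi>) = 1"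
    and antipode_left: "contract2 (\<lambda>x y. S x * \<alpha> * y) (\<Delta> a) = \<epsilon> a *s \<alpha>"
    and antipode_right: "contract2 (\<lambda>x y. x * \<beta> * S y) (\<Delta> a) = \<epsilon> a *s \<beta>"

text \<open>
  In the two hexagon identities the legs of \<open>\<Phi>\<close> are permuted as follows: writing
  \<open>\<Phi>\<close> as a sum of pure tensors [X, Y, Z], the subscript 132 gives [X, Z, Y],
  213 gives [Y, X, Z], 231 gives [Y, Z, X] and 312 gives [Z, X, Y].
\<close>

locale quasitriangular_quasi_hopf_algebra = quasi_hopf_algebra scale \<Delta> \<epsilon> \<Phi> S \<alpha> \<beta>
  for scale :: "'k::field \<Rightarrow> 'a::ring_1 \<Rightarrow> 'a" (infixr "*s" 75)
    and \<Delta> :: "'a \<Rightarrow> ('a, 'k) formal set"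
    and \<epsilon> :: "'a \<Rightarrow> 'k"
    and \<Phi> :: "('a, 'k) formal set"
    and S :: "'a \<Rightarrow> 'a"
    and \<alpha> :: 'a
    and \<beta> :: 'a +
  fixes R :: "('a, 'k) formal set"
  assumes rmatrix_unit: "tunit 2 R"
    and rmatrix_comult:
      "tmap 2 (\<lambda>xs. pure [xs ! 1, xs ! 0]) (\<Delta> a) \<odot>\<^bsub>2\<^esub> R = R \<odot>\<^bsub>2\<^esub> \<Delta> a"
    and hexagon_left:
      "map_leg \<Delta> 3 0 R =
         tinv 3 (tmap 3 (\<lambda>xs. pure [xs ! 1, xs ! 2, xs ! 0]) \<Phi>)
         \<odot>\<^bsub>3\<^esub> tmap 3 (\<lambda>xs. pure [xs ! 0, 1, xs ! 1]) R
         \<odot>\<^bsub>3\<^esub> tmap 3 (\<lambda>xs. pure [xs ! 0, xs ! 2, xs ! 1]) \<Phi>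
         \<odot>\<^bsub>3\<^esub> tmap 3 (\<lambda>xs. pure [1, xs ! 0, xs ! 1]) R
         \<odot>\<^bsub>3\<^esub> tinv 3 \<Phi>"
    and hexagon_right:
      "map_leg \<Delta> 3 1 R =
         tmap 3 (\<lambda>xs. pure [xs ! 2, xs ! 0, xs ! 1]) \<Phi>
         \<odot>\<^bsub>3\<^esub> tmap 3 (\<lambda>xs. pure [xs ! 0, 1, xs ! 1]) R
         \<odot>\<^bsub>3\<^esub> tinv 3 (tmap 3 (\<lambda>xs. pure [xs ! 1, xs ! 0, xs ! 2]) \<Phi>)
         \<odot>\<^bsub>3\<^esub> tmap 3 (\<lambda>xs. pure [xs ! 0, xs ! 1, 1]) R
         \<odot>\<^bsub>3\<^esub> \<Phi>"

definition (in k_algebra) alpha_R ::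
    "('a \<Rightarrow> 'a) \<Rightarrow> 'a \<Rightarrow> ('a, 'k) formal set \<Rightarrow> 'a" where
  "alpha_R S \<alpha> R = contract2 (\<lambda>x y. S x * \<alpha> * y) (tinv 2 R)"

definition (in k_algebra) beta_R ::
    "('a \<Rightarrow> 'a) \<Rightarrow> 'a \<Rightarrow> ('a, 'k) formal set \<Rightarrow> 'a" where
  "beta_R S \<beta> R = contract2 (\<lambda>x y. x * \<beta> * S y) R"

end

theory Submission
  imports Defs
begin

text \<open>
  The inverse antipode \<open>inv S\<close> is the antipode of the co-opposite quasi-Hopf algebra, whose
  coproduct is the flipped one, whose associator is \<open>\<Phi>\<close> inverted with its legs
  reversed, and in which \<open>inv S \<alpha>\<close> and \<open>inv S \<beta>\<close> take the places of
  \<open>\<alpha>\<close> and \<open>\<beta>\<close>. The R-matrix intertwines the two coproducts, and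
  twisting by it carries this structure back to \<open>\<Delta>\<close> and \<open>\<Phi>\<close>. Hence
  \<open>inv S\<close> is also an antipode for the original coproduct and associator, with the elements
  \<open>alpha_twist\<close> and \<open>beta_twist\<close> (lemmas \<open>quasi_antipode_inv\<close> and
  \<open>inv_antipode_normalized\<close>; the latter is where both hexagons are used, through
  \<open>rmatrix_twists_assoc\<close>).
  
  By a theorem of Drinfeld two antipodes for the same coproduct and associator are conjugate. The
  conjugating element of S and \<open>inv S\<close> is the sum u of S(X) \<open>\<alpha>\<close> Y
  \<open>beta_twist\<close> \<open>inv S\<close>(Z) over \<open>\<Phi>\<close>: coassociativity gives
  S(a) u = u \<open>inv S\<close>(a), and the pentagon gives \<open>\<beta>\<close> u = \<open>beta_twist\<close>
  and, for the sum v with the two antipodes exchanged, v \<open>\<alpha>\<close> = \<open>alpha_twist\<close>.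
  The normalization of \<open>inv S\<close> then makes v a left inverse of u. It is a right inverse as
  well: u v commutes with every value of the square of S, hence with all elements, and this moves the
  factors into the order v u. Cancelling R against its inverse turns the relations with
  \<open>alpha_twist\<close> and \<open>beta_twist\<close> into the ones with \<open>alpha_R\<close> and
  \<open>beta_R\<close> (lemma \<open>drinfeld_element_exists\<close>).
  
  Conversely, let u satisfy the three relations. Then conjugation by u turns each of the four sums into
  \<open>inv S\<close> of one of the two normalization sums of S, up to a factor u or its inverse
  (lemma \<open>twisted_conjugation_formulas\<close>). As the first of the sums contains only given
  data, u is unique.
  
  All computations with tensors are done in the form of Sweedler's notation: a tensor is replaced by
  the functional that sends a multilinear map F to the sum of the values of F on the pure tensors of an
  expression of it. This determines the tensor (lemma \<open>tensor_eqI\<close>), products of tensors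
  become iterated sums, whose order is irrelevant, and every axiom becomes an identity between iterated
  sums with an arbitrary multilinear integrand.
\<close>

section \<open>Linear extension from tuples\<close>

context vector_space
begin

lemma linext_superset:
  assumes "finite K" "Poly_Mapping.keys p \<subseteq> K"
  shows "linext scale g p = (\<Sum>xs\<in>K. scale (Poly_Mapping.lookup p xs) (g xs))"
  unfolding linext_def using assms
  by (intro sum.mono_neutral_left) (auto simp: in_keys_iff)

lemma linext_zero: "linext scale g 0 = 0"
  by (simp add: linext_def)

lemma linext_add: "linext scale g (p + q) = linext scale g p + linext scale g q"
proof -
  let ?K = "Poly_Mapping.keys p \<union> Poly_Mapping.keys q"
  have "Poly_Mapping.keys (p + q) \<subseteq> ?K" by (rule keys_add)
  then show ?thesis
    by (simp add: linext_superset[of ?K] lookup_add scale_left_distrib sum.distrib)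
qed

lemma linext_fscale: "linext scale g (fscale c p) = scale c (linext scale g p)"
proof -
  have "Poly_Mapping.keys (fscale c p) \<subseteq> Poly_Mapping.keys p"
    by (auto simp: in_keys_iff lookup_fscale)
  then show ?thesis
    by (simp add: linext_superset[of "Poly_Mapping.keys p"] lookup_fscale scale_sum_right)
qed

lemma linext_diff: "linext scale g (p - q) = linext scale g p - linext scale g q"
  using linext_add[of g "p - q" q] by simp

lemma linext_pure: "linext scale g (pure xs) = g xs"
  by (simp add: linext_def pure_def)

lemma linext_sum: "linext scale g (sum f I) = (\<Sum>i\<in>I. linext scale g (f i))"
  by (induction I rule: infinite_finite_induct) (auto simp: linext_zero linext_add)

lemma linext_linext:
  "linext scale g (linext fscale f p) = linext scale (\<lambda>xs. linext scale g (f xs)) p"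
  by (simp add: linext_def[of fscale] linext_def[of _ "\<lambda>xs. linext scale g (f xs)"]
      linext_sum linext_fscale)

lemma linext_span_zero:
  assumes "p \<in> formal.span A" and "\<And>r. r \<in> A \<Longrightarrow> linext scale g r = 0"
  shows "linext scale g p = 0"
  using assms(1)
  by (induction rule: formal.span_induct_alt)
    (auto simp: linext_zero linext_add linext_fscale assms(2))

text \<open>
  Both sides are double sums over finite supports; this is what makes the order of iterated sums over
  tensors irrelevant.
\<close>
lemma linext_swap:
  "linext scale (\<lambda>xs. linext scale (\<lambda>ys. f xs ys) q) p =
   linext scale (\<lambda>ys. linext scale (\<lambda>xs. f xs ys) p) q"
  unfolding linext_def scale_sum_right
  by (subst sum.swap) (simp add: mult.commute)

lemma linext_of_linear:
  assumes "module_hom scale sc h"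
  shows "h (linext scale g p) = linext sc (\<lambda>xs. h (g xs)) p"
  using assms by (simp add: linext_def module_hom.sum module_hom.scale)

end

lemma linext_pure_id: "linext fscale pure p = p"
proof -
  have "(\<Sum>xs\<in>Poly_Mapping.keys p. Poly_Mapping.lookup p xs * Poly_Mapping.lookup (pure xs) ys) =
      Poly_Mapping.lookup p ys" for ys
    by (simp add: pure_def lookup_single when_def if_distrib[of "\<lambda>x. _ * x"] in_keys_iff
        cong: if_cong)
  then show ?thesis
    by (intro poly_mapping_eqI) (simp add: linext_def lookup_sum lookup_fscale)
qed

lemma linext_formals:
  assumes "p \<in> formals m" and "\<And>xs. length xs = m \<Longrightarrow> f xs \<in> formals n"
  shows "linext fscale f p \<in> formals n"
proof -
  have "formal.subspace (formals n)"
    unfolding formal.subspace_def formals_def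
    using keys_add by (fastforce simp: in_keys_iff lookup_fscale)
  then show ?thesis
    unfolding linext_def
    by (intro formal.subspace_sum formal.subspace_scale) (use assms in \<open>auto simp: formals_def\<close>)
qed

lemma pure_formals: "length xs = n \<Longrightarrow> pure xs \<in> formals n"
  by (simp add: formals_def pure_def)

text \<open>
  A basis of the span of A stays independent when p is added, so that a linear functional can be
  prescribed to vanish on it and to be 1 at p.
\<close>
lemma separating_functional:
  assumes "p \<notin> formal.span A"
  obtains \<phi> :: "('a, 'k::field) formal \<Rightarrow> 'k"
    where "Vector_Spaces.linear fscale (*) \<phi>" "\<And>r. r \<in> A \<Longrightarrow> \<phi> r = 0" "\<phi> p = 1"
proof -
  interpret fk: vector_space_pair "fscale :: 'k \<Rightarrow> ('a, 'k) formal \<Rightarrow> _" "(*) :: 'k \<Rightarrow> 'k \<Rightarrow> 'k"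
    by unfold_locales (auto simp: algebra_simps)
  obtain B where B: "B \<subseteq> A" "formal.independent B" "A \<subseteq> formal.span B"
    by (rule formal.maximal_independent_subset[of A])
  have "p \<notin> formal.span B"
    using assms formal.span_mono[OF B(1)] by auto
  then have "formal.independent (insert p B)" and pB: "p \<notin> B"
    using B(2) by (rule formal.independent_insertI, auto intro: formal.span_base)
  then obtain \<phi> where \<phi>: "Vector_Spaces.linear fscale (*) \<phi>"
      "\<forall>x\<in>insert p B. \<phi> x = (if x = p then 1 else 0)"
    using fk.linear_independent_extend[of "insert p B" "\<lambda>x. if x = p then 1 else 0"] by blast
  have "\<phi> r = 0" if "r \<in> A" for r
  proof (rule fk.linear_eq_0_on_span[OF \<phi>(1)])
    show "r \<in> formal.span B" using B(3) that by blast
    show "\<phi> x = 0" if "x \<in> B" for x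
      using \<phi>(2) pB that by (cases "x = p") auto
  qed
  with \<phi> that show ?thesis by simp
qed

section \<open>Tensors as functionals on multilinear maps\<close>

context k_algebra
begin

text \<open>
  Linearity of a map of the algebra into itself, as a plain predicate on functions, so that linearity
  of a sum in one of its variables can be derived by resolution with closure rules.
\<close>
definition klin :: "('a \<Rightarrow> 'a) \<Rightarrow> bool" where
  "klin f \<longleftrightarrow> (\<forall>x y. f (x + y) = f x + f y) \<and> (\<forall>c x. f (c *s x) = c *s f x)"

definition bilin :: "('a \<Rightarrow> 'a \<Rightarrow> 'a) \<Rightarrow> bool" where
  "bilin F \<longleftrightarrow> (\<forall>y. klin (\<lambda>x. F x y)) \<and> (\<forall>x. klin (\<lambda>y. F x y))"

definition trilin :: "('a \<Rightarrow> 'a \<Rightarrow> 'a \<Rightarrow> 'a) \<Rightarrow> bool" where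
  "trilin F \<longleftrightarrow> (\<forall>y z. klin (\<lambda>x. F x y z)) \<and> (\<forall>x z. klin (\<lambda>y. F x y z)) \<and>
     (\<forall>x y. klin (\<lambda>z. F x y z))"

definition quadrilin :: "('a \<Rightarrow> 'a \<Rightarrow> 'a \<Rightarrow> 'a \<Rightarrow> 'a) \<Rightarrow> bool" where
  "quadrilin F \<longleftrightarrow> (\<forall>y z t. klin (\<lambda>x. F x y z t)) \<and> (\<forall>x z t. klin (\<lambda>y. F x y z t)) \<and>
     (\<forall>x y t. klin (\<lambda>z. F x y z t)) \<and> (\<forall>x y z. klin (\<lambda>t. F x y z t))"

definition multilinear :: "nat \<Rightarrow> ('a list \<Rightarrow> 'a) \<Rightarrow> bool" where
  "multilinear n G \<longleftrightarrow>
     (\<forall>xs ys. length xs + length ys + 1 = n \<longrightarrow> klin (\<lambda>x. G (xs @ x # ys)))"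

text \<open>
  The functional on integrands that a tensor induces; for n = 2 and n = 3 it is \<open>contract2\<close>
  and \<open>contract3\<close> with the integrand written on lists.
\<close>
definition tsum :: "('a list \<Rightarrow> 'a) \<Rightarrow> ('a, 'k) formal set \<Rightarrow> 'a" where
  "tsum G X = linext scale G (expr X)"

definition contract4 :: "('a \<Rightarrow> 'a \<Rightarrow> 'a \<Rightarrow> 'a \<Rightarrow> 'a) \<Rightarrow> ('a, 'k) formal set \<Rightarrow> 'a" where
  "contract4 F X = tsum (\<lambda>xs. F (xs ! 0) (xs ! 1) (xs ! 2) (xs ! 3)) X"

lemma contract2_tsum: "contract2 F X = tsum (\<lambda>xs. F (xs ! 0) (xs ! 1)) X"
  by (simp add: contract2_def tsum_def)

lemma contract3_tsum: "contract3 F X = tsum (\<lambda>xs. F (xs ! 0) (xs ! 1) (xs ! 2)) X"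
  by (simp add: contract3_def tsum_def)

lemmas contract_tsum = contract2_tsum contract3_tsum contract4_def

lemma bilinI: "(\<And>y. klin (\<lambda>x. F x y)) \<Longrightarrow> (\<And>x. klin (\<lambda>y. F x y)) \<Longrightarrow> bilin F"
  by (simp add: bilin_def)

lemma trilinI:
  "(\<And>y z. klin (\<lambda>x. F x y z)) \<Longrightarrow> (\<And>x z. klin (\<lambda>y. F x y z)) \<Longrightarrow> (\<And>x y. klin (\<lambda>z. F x y z)) \<Longrightarrow>
   trilin F"
  by (simp add: trilin_def)

lemma quadrilinI:
  "(\<And>y z t. klin (\<lambda>x. F x y z t)) \<Longrightarrow> (\<And>x z t. klin (\<lambda>y. F x y z t)) \<Longrightarrow>
   (\<And>x y t. klin (\<lambda>z. F x y z t)) \<Longrightarrow> (\<And>x y z. klin (\<lambda>t. F x y z t)) \<Longrightarrow> quadrilin F"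
  by (simp add: quadrilin_def)

lemma klin_comp: "klin L \<Longrightarrow> klin f \<Longrightarrow> klin (\<lambda>x. L (f x))"
  by (simp add: klin_def)

lemma bilin_comp:
  assumes "bilin F"
  shows "klin f \<Longrightarrow> klin (\<lambda>x. F (f x) b)" "klin f \<Longrightarrow> klin (\<lambda>x. F b (f x))"
  using assms by (simp_all add: klin_def bilin_def)

lemma trilin_comp:
  assumes "trilin F"
  shows "klin f \<Longrightarrow> klin (\<lambda>x. F (f x) b c)" "klin f \<Longrightarrow> klin (\<lambda>x. F b (f x) c)"
    "klin f \<Longrightarrow> klin (\<lambda>x. F b c (f x))"
  using assms by (simp_all add: klin_def trilin_def)

lemma quadrilin_comp:
  assumes "quadrilin F"
  shows "klin f \<Longrightarrow> klin (\<lambda>x. F (f x) b c d)" "klin f \<Longrightarrow> klin (\<lambda>x. F b (f x) c d)"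
    "klin f \<Longrightarrow> klin (\<lambda>x. F b c (f x) d)" "klin f \<Longrightarrow> klin (\<lambda>x. F b c d (f x))"
  using assms by (simp_all add: klin_def quadrilin_def)

lemma klin_id: "klin (\<lambda>x. x)"
  by (simp add: klin_def)

lemma klin_mult_right: "klin f \<Longrightarrow> klin (\<lambda>x. f x * a)"
  by (simp add: klin_def distrib_right scale_mult_left)

lemma klin_mult_left: "klin f \<Longrightarrow> klin (\<lambda>x. a * f x)"
  by (simp add: klin_def distrib_left scale_mult_right)

lemma klin_scale: "klin f \<Longrightarrow> klin (\<lambda>x. c *s f x)"
  by (simp add: klin_def scale_right_distrib mult.commute)

lemma klin_tsum:
  assumes "\<And>xs. klin (\<lambda>a. G a xs)"
  shows "klin (\<lambda>a. tsum (G a) X)"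
  using assms
  by (simp add: klin_def tsum_def linext_def scale_right_distrib sum.distrib scale_sum_right
      mult.commute)

lemma klin_contract2: "(\<And>x y. klin (\<lambda>a. F a x y)) \<Longrightarrow> klin (\<lambda>a. contract2 (F a) X)"
  unfolding contract2_tsum by (rule klin_tsum)

lemma klin_contract3: "(\<And>x y z. klin (\<lambda>a. F a x y z)) \<Longrightarrow> klin (\<lambda>a. contract3 (F a) X)"
  unfolding contract3_tsum by (rule klin_tsum)

text \<open>
  The rules for products and scalar multiples allow the variable in one argument only, so at most one
  rule applies to a function that depends on its variable, and resolution needs no search.
\<close>
lemmas klin_intros = klin_id klin_mult_right klin_mult_left klin_scale klin_contract2 klin_contract3

lemma klin_of_tsum:
  assumes "klin L"
  shows "L (tsum G X) = tsum (\<lambda>xs. L (G xs)) X"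
proof -
  have "module_hom scale scale L"
    using assms by unfold_locales (auto simp: klin_def)
  then show ?thesis
    unfolding tsum_def by (rule linext_of_linear)
qed

lemma klin_of_contract2: "klin L \<Longrightarrow> L (contract2 F X) = contract2 (\<lambda>x y. L (F x y)) X"
  unfolding contract2_tsum by (rule klin_of_tsum)

lemma klin_of_contract3: "klin L \<Longrightarrow> L (contract3 F X) = contract3 (\<lambda>x y z. L (F x y z)) X"
  unfolding contract3_tsum by (rule klin_of_tsum)

lemma tsum_swap:
  "tsum (\<lambda>xs. tsum (\<lambda>ys. G xs ys) Y) X = tsum (\<lambda>ys. tsum (\<lambda>xs. G xs ys) X) Y"
  unfolding tsum_def by (rule linext_swap)

lemma contract_swap22: "contract2 (\<lambda>x y. contract2 (\<lambda>a b. F x y a b) Y) X =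
    contract2 (\<lambda>a b. contract2 (\<lambda>x y. F x y a b) X) Y"
  unfolding contract_tsum by (rule tsum_swap)

lemma contract_swap23: "contract2 (\<lambda>x y. contract3 (\<lambda>a b c. F x y a b c) Y) X =
    contract3 (\<lambda>a b c. contract2 (\<lambda>x y. F x y a b c) X) Y"
  unfolding contract_tsum by (rule tsum_swap)

lemma contract_swap33: "contract3 (\<lambda>x y z. contract3 (\<lambda>a b c. F x y z a b c) Y) X =
    contract3 (\<lambda>a b c. contract3 (\<lambda>x y z. F x y z a b c) X) Y"
  unfolding contract_tsum by (rule tsum_swap)

lemma linext_multilinear_rel:
  assumes "multilinear n G" "r \<in> multilinear_rels n"
  shows "linext scale G r = 0"
proof -
  consider (add) xs x y ys where "length xs + length ys + 1 = n"
      "r = pure (xs @ (x + y) # ys) - pure (xs @ x # ys) - pure (xs @ y # ys)"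
    | (scale) xs c x ys where "length xs + length ys + 1 = n"
      "r = pure (xs @ (c *s x) # ys) - fscale c (pure (xs @ x # ys))"
    using assms(2) unfolding multilinear_rels_def by blast
  then show ?thesis
  proof cases
    case add
    then have "G (xs @ (x + y) # ys) = G (xs @ x # ys) + G (xs @ y # ys)"
      using assms(1) unfolding multilinear_def klin_def by blast
    with add(2) show ?thesis by (simp add: linext_diff linext_pure)
  next
    case scale
    then have "G (xs @ (c *s x) # ys) = c *s G (xs @ x # ys)"
      using assms(1) unfolding multilinear_def klin_def by blast
    with scale(2) show ?thesis by (simp add: linext_diff linext_pure linext_fscale)
  qed
qed

lemma tclass_self: "p \<in> formals n \<Longrightarrow> p \<in> tclass n p"
  by (simp add: tclass_def formal.span_zero)

lemma expr_tclass: "p \<in> formals n \<Longrightarrow> expr (tclass n p) \<in> tclass n p"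
  unfolding expr_def by (rule someI) (rule tclass_self)

lemma expr_formals: "X \<in> tpower n \<Longrightarrow> expr X \<in> formals n"
  using expr_tclass by (auto simp: tpower_def tclass_def)

lemma tclass_in_tpower: "p \<in> formals n \<Longrightarrow> tclass n p \<in> tpower n"
  by (simp add: tpower_def)

lemma tclass_eqI:
  assumes "p - q \<in> formal.span (multilinear_rels n)"
  shows "tclass n p = tclass n q"
proof -
  have "r - p \<in> formal.span (multilinear_rels n) \<longleftrightarrow> r - q \<in> formal.span (multilinear_rels n)" for r
    using formal.span_add[OF _ assms, of "r - p"] formal.span_diff[OF _ assms, of "r - q"]
    by (auto simp: algebra_simps)
  then show ?thesis by (simp add: tclass_def)
qed

lemma tclass_expr:
  assumes "X \<in> tpower n"
  shows "tclass n (expr X) = X"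
proof -
  obtain p where p: "p \<in> formals n" "X = tclass n p"
    using assms by (auto simp: tpower_def)
  from expr_tclass[OF p(1)] have "expr X - p \<in> formal.span (multilinear_rels n)"
    unfolding p(2) tclass_def by simp
  from tclass_eqI[OF this] p(2) show ?thesis by simp
qed

text \<open>
  A multilinear integrand kills the multilinearity relations, so its sum does not depend on the
  expression of the tensor.
\<close>
lemma tsum_tclass:
  assumes "multilinear n G" "p \<in> formals n"
  shows "tsum G (tclass n p) = linext scale G p"
proof -
  have "linext scale G (expr (tclass n p) - p) = 0"
  proof (rule linext_span_zero)
    show "expr (tclass n p) - p \<in> formal.span (multilinear_rels n)"
      using expr_tclass[OF assms(2)] unfolding tclass_def by simp
  qed (rule linext_multilinear_rel[OF assms(1)])
  then show ?thesis by (simp add: tsum_def linext_diff)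
qed

lemma tsum_cong:
  assumes "X \<in> tpower n" "\<And>xs. length xs = n \<Longrightarrow> G xs = H xs"
  shows "tsum G X = tsum H X"
  unfolding tsum_def linext_def using expr_formals[OF assms(1)] assms(2)
  by (intro sum.cong) (auto simp: formals_def)

text \<open>
  If the difference of two expressions is not in the span of the relations, then a linear functional
  separates it from them; restricted to pure tensors and multiplied by the unit of the algebra this
  functional is a multilinear integrand with different sums.
\<close>
lemma tensor_eqI:
  assumes X: "X \<in> tpower n" and Y: "Y \<in> tpower n"
    and eq: "\<And>G. multilinear n G \<Longrightarrow> tsum G X = tsum G Y"
  shows "X = Y"
proof (rule ccontr)
  let ?p = "expr X - expr Y"
  assume "X \<noteq> Y"
  then have "?p \<notin> formal.span (multilinear_rels n)"
    using tclass_eqI[of "expr X" "expr Y" n] tclass_expr X Y by metis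
  then obtain \<phi> :: "('a, 'k) formal \<Rightarrow> 'k"
    where \<phi>: "Vector_Spaces.linear fscale (*) \<phi>" "\<And>r. r \<in> multilinear_rels n \<Longrightarrow> \<phi> r = 0" "\<phi> ?p = 1"
    by (rule separating_functional) blast
  interpret \<phi>: Vector_Spaces.linear fscale "(*)" \<phi> by (rule \<phi>(1))
  define G :: "'a list \<Rightarrow> 'a" where "G xs = \<phi> (pure xs) *s 1" for xs
  have "multilinear n G"
  proof -
    have "G (xs @ (x + y) # ys) = G (xs @ x # ys) + G (xs @ y # ys)"
      if "length xs + length ys + 1 = n" for xs x y ys
    proof -
      have "\<phi> (pure (xs @ (x + y) # ys) - pure (xs @ x # ys) - pure (xs @ y # ys)) = 0"
        using that by (intro \<phi>(2)) (unfold multilinear_rels_def, blast)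
      then have "\<phi> (pure (xs @ (x + y) # ys)) = \<phi> (pure (xs @ x # ys)) + \<phi> (pure (xs @ y # ys))"
        unfolding \<phi>.diff by (simp add: algebra_simps)
      then show ?thesis by (simp add: G_def scale_left_distrib)
    qed
    moreover have "G (xs @ (c *s x) # ys) = c *s G (xs @ x # ys)"
      if "length xs + length ys + 1 = n" for xs c x ys
    proof -
      have "\<phi> (pure (xs @ (c *s x) # ys) - fscale c (pure (xs @ x # ys))) = 0"
        using that by (intro \<phi>(2)) (unfold multilinear_rels_def, blast)
      then show ?thesis by (simp add: G_def \<phi>.diff \<phi>.scale)
    qed
    ultimately show ?thesis by (simp add: multilinear_def klin_def)
  qed
  moreover have "linext scale G p = \<phi> p *s 1" for p
  proof -
    have "module_hom fscale scale (\<lambda>q. \<phi> q *s 1)"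
      by unfold_locales (simp_all add: \<phi>.add \<phi>.scale scale_left_distrib scale_right_distrib)
    from formal.linext_of_linear[OF this, of pure p] show ?thesis
      by (simp add: linext_pure_id G_def[abs_def])
  qed
  ultimately have "\<phi> (expr X) *s 1 = \<phi> (expr Y) *s (1::'a)"
    using eq[of G] by (simp add: tsum_def)
  with \<phi>(3) show False by (simp add: \<phi>.diff)
qed

lemma tmap_in_tpower:
  "X \<in> tpower m \<Longrightarrow> (\<And>xs. length xs = m \<Longrightarrow> f xs \<in> formals n) \<Longrightarrow> tmap n f X \<in> tpower n"
  unfolding tmap_def by (intro tclass_in_tpower linext_formals) (auto intro: expr_formals)

text \<open>
  \<open>tmap\<close> and \<open>tsum\<close> use the same expression of X, so this is a composition
  of linear extensions.
\<close>
lemma tsum_tmap: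
  assumes "multilinear n G" "X \<in> tpower m" "\<And>xs. length xs = m \<Longrightarrow> f xs \<in> formals n"
  shows "tsum G (tmap n f X) = tsum (\<lambda>xs. linext scale G (f xs)) X"
proof -
  have "linext fscale f (expr X) \<in> formals n"
    using assms(2,3) by (intro linext_formals) (auto intro: expr_formals)
  from tsum_tclass[OF assms(1) this] show ?thesis
    by (simp add: tmap_def linext_linext tsum_def)
qed

lemma tsum_tmap_pure:
  assumes "multilinear n G" "X \<in> tpower m" "\<And>xs. length xs = m \<Longrightarrow> length (f xs) = n"
  shows "tsum G (tmap n (\<lambda>xs. pure (f xs)) X) = tsum (\<lambda>xs. G (f xs)) X"
  using tsum_tmap[OF assms(1,2), of "\<lambda>xs. pure (f xs)"] assms(3)
  by (simp add: linext_pure pure_formals)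

lemma tmult_in_tpower:
  assumes "X \<in> tpower n" "Y \<in> tpower n"
  shows "X \<odot>\<^bsub>n\<^esub> Y \<in> tpower n"
  unfolding tmult_def
  by (intro tmap_in_tpower[OF assms(1)] linext_formals[OF expr_formals[OF assms(2)]] pure_formals)
    simp

lemma tsum_tmult:
  assumes "multilinear n G" "X \<in> tpower n" "Y \<in> tpower n"
  shows "tsum G (X \<odot>\<^bsub>n\<^esub> Y) = tsum (\<lambda>xs. tsum (\<lambda>ys. G (map2 (*) xs ys)) Y) X"
  unfolding tmult_def
  by (subst tsum_tmap[OF assms(1,2)])
    (simp_all add: linext_formals[OF expr_formals[OF assms(3)]] pure_formals
      linext_linext linext_pure tsum_def)

lemma tone_in_tpower: "tone n \<in> tpower n"
  unfolding tone_def by (intro tclass_in_tpower pure_formals) simp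

lemma tsum_tone: "multilinear n G \<Longrightarrow> tsum G (tone n) = G (replicate n 1)"
  unfolding tone_def by (subst tsum_tclass) (simp_all add: pure_formals linext_pure)

lemma tsum_tplus:
  assumes "multilinear n G" "X \<in> tpower n" "Y \<in> tpower n"
  shows "tsum G (tplus n X Y) = tsum G X + tsum G Y"
proof -
  have "expr X + expr Y \<in> formals n"
    using expr_formals[OF assms(2)] expr_formals[OF assms(3)] keys_add[of "expr X" "expr Y"]
    unfolding formals_def by blast
  then show ?thesis
    unfolding tplus_def by (simp add: tsum_tclass[OF assms(1)] linext_add tsum_def[symmetric])
qed

lemma tsum_tscale:
  assumes "multilinear n G" "X \<in> tpower n"
  shows "tsum G (tscale n c X) = c *s tsum G X"
proof -
  have "fscale c (expr X) \<in> formals n"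
    using expr_formals[OF assms(2)] by (auto simp: formals_def in_keys_iff lookup_fscale)
  then show ?thesis
    unfolding tscale_def by (simp add: tsum_tclass[OF assms(1)] linext_fscale tsum_def[symmetric])
qed

lemma map_leg_in_tpower:
  assumes "\<And>a. D a \<in> tpower 2" "X \<in> tpower m" "n = m + 1" "i < m"
  shows "map_leg D n i X \<in> tpower n"
  unfolding map_leg_def
  by (intro tmap_in_tpower[OF assms(2)] linext_formals[OF expr_formals[OF assms(1)]] pure_formals)
    (use assms(3,4) in simp)

lemma tsum_map_leg:
  assumes "multilinear n G" "\<And>a. D a \<in> tpower 2" "X \<in> tpower m" "n = m + 1" "i < m"
  shows "tsum G (map_leg D n i X) =
    tsum (\<lambda>xs. tsum (\<lambda>ds. G (take i xs @ ds @ drop (Suc i) xs)) (D (xs ! i))) X"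
  unfolding map_leg_def
  by (subst tsum_tmap[OF assms(1,3)])
    (use assms(4,5) in \<open>simp_all add: linext_formals[OF expr_formals[OF assms(2)]] pure_formals
      linext_linext linext_pure tsum_def\<close>)

lemma list_split_at:
  assumes "length us + length vs + 1 = n" "length ys = n"
  obtains as b cs where "ys = as @ b # cs" "length as = length us" "length cs = length vs"
  using assms id_take_nth_drop[of "length us" ys]
  by (intro that[of "take (length us) ys" "ys ! length us" "drop (Suc (length us)) ys"]) auto

lemma multilinear_map2_left:
  assumes "multilinear n G" "length ys = n"
  shows "multilinear n (\<lambda>xs. G (map2 (*) xs ys))"
  unfolding multilinear_def
proof (intro allI impI)
  fix us vs :: "'a list"
  assume len: "length us + length vs + 1 = n"
  from list_split_at[OF this assms(2)]
  obtain as b cs where ys: "ys = as @ b # cs" "length as = length us" "length cs = length vs" .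
  have "klin (\<lambda>x. G (map2 (*) us as @ x # map2 (*) vs cs))"
    using assms(1) len ys unfolding multilinear_def by simp
  then have "klin (\<lambda>x. G (map2 (*) us as @ (x * b) # map2 (*) vs cs))"
    by (rule klin_comp) (intro klin_intros)
  then show "klin (\<lambda>x. G (map2 (*) (us @ x # vs) ys))"
    using ys by simp
qed

lemma multilinear_map2_right:
  assumes "multilinear n G" "length xs = n"
  shows "multilinear n (\<lambda>ys. G (map2 (*) xs ys))"
  unfolding multilinear_def
proof (intro allI impI)
  fix us vs :: "'a list"
  assume len: "length us + length vs + 1 = n"
  from list_split_at[OF this assms(2)]
  obtain as b cs where xs: "xs = as @ b # cs" "length as = length us" "length cs = length vs" .
  have "klin (\<lambda>x. G (map2 (*) as us @ x # map2 (*) cs vs))"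
    using assms(1) len xs unfolding multilinear_def by simp
  then have "klin (\<lambda>x. G (map2 (*) as us @ (b * x) # map2 (*) cs vs))"
    by (rule klin_comp) (intro klin_intros)
  then show "klin (\<lambda>x. G (map2 (*) xs (us @ x # vs)))"
    using xs by simp
qed

text \<open>
  Tuples of other lengths than m do not occur in an expression of Y, so the integrand may be replaced by
  0 there.
\<close>
lemma multilinear_tsum:
  assumes Y: "Y \<in> tpower m" and G: "\<And>ys. length ys = m \<Longrightarrow> multilinear n (\<lambda>xs. G xs ys)"
  shows "multilinear n (\<lambda>xs. tsum (G xs) Y)"
  unfolding multilinear_def
proof (intro allI impI)
  fix us vs :: "'a list"
  assume len: "length us + length vs + 1 = n"
  have "klin (\<lambda>x. tsum (\<lambda>ys. if length ys = m then G (us @ x # vs) ys else 0) Y)"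
  proof (rule klin_tsum)
    fix ys :: "'a list"
    show "klin (\<lambda>x. if length ys = m then G (us @ x # vs) ys else 0)"
      using G[of ys] len by (cases "length ys = m") (auto simp: multilinear_def klin_def)
  qed
  moreover have "tsum (\<lambda>ys. if length ys = m then G (us @ x # vs) ys else 0) Y =
      tsum (G (us @ x # vs)) Y" for x
    by (rule tsum_cong[OF Y]) simp
  ultimately show "klin (\<lambda>x. tsum (G (us @ x # vs)) Y)" by simp
qed

lemma tmult_assoc:
  assumes X: "X \<in> tpower n" and Y: "Y \<in> tpower n" and Z: "Z \<in> tpower n"
  shows "(X \<odot>\<^bsub>n\<^esub> Y) \<odot>\<^bsub>n\<^esub> Z = X \<odot>\<^bsub>n\<^esub> (Y \<odot>\<^bsub>n\<^esub> Z)"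
proof (rule tensor_eqI[of _ n])
  fix G :: "'a list \<Rightarrow> 'a" assume G: "multilinear n G"
  have "tsum G ((X \<odot>\<^bsub>n\<^esub> Y) \<odot>\<^bsub>n\<^esub> Z) =
      tsum (\<lambda>ws. tsum (\<lambda>zs. G (map2 (*) ws zs)) Z) (X \<odot>\<^bsub>n\<^esub> Y)"
    by (intro tsum_tmult G tmult_in_tpower X Y Z)
  also have "\<dots> = tsum (\<lambda>xs. tsum (\<lambda>ys. tsum (\<lambda>zs. G (map2 (*) (map2 (*) xs ys) zs)) Z) Y) X"
    by (intro tsum_tmult multilinear_tsum[OF Z] multilinear_map2_left[OF G] X Y)
  also have "\<dots> = tsum (\<lambda>xs. tsum (\<lambda>ys. tsum (\<lambda>zs. G (map2 (*) xs (map2 (*) ys zs))) Z) Y) X"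
  proof -
    have "map2 (*) (map2 (*) xs ys) zs = map2 (*) xs (map2 (*) ys zs)" for xs ys zs :: "'a list"
      by (rule nth_equalityI) (simp_all add: mult.assoc)
    then show ?thesis by simp
  qed
  also have "\<dots> = tsum (\<lambda>xs. tsum (\<lambda>ws. G (map2 (*) xs ws)) (Y \<odot>\<^bsub>n\<^esub> Z)) X"
    by (intro tsum_cong[OF X] tsum_tmult[symmetric] multilinear_map2_right[OF G] Y Z)
  also have "\<dots> = tsum G (X \<odot>\<^bsub>n\<^esub> (Y \<odot>\<^bsub>n\<^esub> Z))"
    by (intro tsum_tmult[symmetric] G tmult_in_tpower X Y Z)
  finally show "tsum G ((X \<odot>\<^bsub>n\<^esub> Y) \<odot>\<^bsub>n\<^esub> Z) = tsum G (X \<odot>\<^bsub>n\<^esub> (Y \<odot>\<^bsub>n\<^esub> Z))" .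
qed (intro tmult_in_tpower X Y Z)+

lemma tmult_tone_left:
  assumes X: "X \<in> tpower n"
  shows "tone n \<odot>\<^bsub>n\<^esub> X = X"
proof (rule tensor_eqI[of _ n])
  fix G :: "'a list \<Rightarrow> 'a" assume G: "multilinear n G"
  have "tsum G (tone n \<odot>\<^bsub>n\<^esub> X) = tsum (\<lambda>xs. G (map2 (*) (replicate n 1) xs)) X"
    by (simp add: tsum_tmult[OF G tone_in_tpower X]
        tsum_tone[OF multilinear_tsum[OF X multilinear_map2_left[OF G]]])
  also have "\<dots> = tsum G X"
    by (intro tsum_cong[OF X] arg_cong[of _ _ G] nth_equalityI) simp_all
  finally show "tsum G (tone n \<odot>\<^bsub>n\<^esub> X) = tsum G X" .
qed (intro tmult_in_tpower tone_in_tpower X)+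

lemma tmult_tone_right:
  assumes X: "X \<in> tpower n"
  shows "X \<odot>\<^bsub>n\<^esub> tone n = X"
proof (rule tensor_eqI[of _ n])
  fix G :: "'a list \<Rightarrow> 'a" assume G: "multilinear n G"
  have "tsum G (X \<odot>\<^bsub>n\<^esub> tone n) = tsum (\<lambda>xs. tsum (\<lambda>ys. G (map2 (*) xs ys)) (tone n)) X"
    by (rule tsum_tmult[OF G X tone_in_tpower])
  also have "\<dots> = tsum (\<lambda>xs. G (map2 (*) xs (replicate n 1))) X"
    by (intro tsum_cong[OF X] tsum_tone multilinear_map2_right[OF G])
  also have "\<dots> = tsum G X"
    by (intro tsum_cong[OF X] arg_cong[of _ _ G] nth_equalityI) simp_all
  finally show "tsum G (X \<odot>\<^bsub>n\<^esub> tone n) = tsum G X" .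
qed (intro tmult_in_tpower tone_in_tpower X)+

lemma is_tinv_unique:
  assumes X: "X \<in> tpower n" and Y: "is_tinv n X Y" and Z: "is_tinv n X Z"
  shows "Y = Z"
proof -
  have YZ: "Y \<in> tpower n" "Z \<in> tpower n" using Y Z by (auto simp: is_tinv_def)
  have "Y = Y \<odot>\<^bsub>n\<^esub> (X \<odot>\<^bsub>n\<^esub> Z)"
    using Z YZ by (simp add: is_tinv_def tmult_tone_right)
  also have "\<dots> = (Y \<odot>\<^bsub>n\<^esub> X) \<odot>\<^bsub>n\<^esub> Z"
    using tmult_assoc[OF YZ(1) X YZ(2)] by simp
  also have "\<dots> = Z"
    using Y YZ by (simp add: is_tinv_def tmult_tone_left)
  finally show ?thesis .
qed

lemma tinv_eqI: "X \<in> tpower n \<Longrightarrow> is_tinv n X Y \<Longrightarrow> tinv n X = Y"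
  unfolding tinv_def by (rule the_equality) (simp_all add: is_tinv_unique)

lemma is_tinv_tinv: "tunit n X \<Longrightarrow> is_tinv n X (tinv n X)"
  unfolding tunit_def using tinv_eqI by blast

lemma list_of_length2: "length xs = 2 \<Longrightarrow> \<exists>x y. xs = [x, y]"
  by (auto simp: numeral_2_eq_2 length_Suc_conv)

lemma list_of_length3: "length xs = 3 \<Longrightarrow> \<exists>x y z. xs = [x, y, z]"
  by (auto simp: numeral_3_eq_3 length_Suc_conv)

lemma multilinear2:
  assumes "bilin F"
  shows "multilinear 2 (\<lambda>xs. F (xs ! 0) (xs ! 1))"
  unfolding multilinear_def
proof (intro allI impI)
  fix xs ys :: "'a list" assume "length xs + length ys + 1 = 2"
  then consider a where "xs = []" "ys = [a]" | a where "xs = [a]" "ys = []"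
    by (cases xs; cases ys) auto
  then show "klin (\<lambda>x. F ((xs @ x # ys) ! 0) ((xs @ x # ys) ! 1))"
    by cases (use assms in \<open>simp_all add: bilin_def\<close>)
qed

lemma multilinear3:
  assumes "trilin F"
  shows "multilinear 3 (\<lambda>xs. F (xs ! 0) (xs ! 1) (xs ! 2))"
  unfolding multilinear_def
proof (intro allI impI)
  fix xs ys :: "'a list" assume "length xs + length ys + 1 = 3"
  then have "length xs + length ys = 2" by simp
  then consider a b where "xs = []" "ys = [a, b]" | a b where "xs = [a]" "ys = [b]"
    | a b where "xs = [a, b]" "ys = []"
    using list_of_length2[of "xs @ ys"] by (auto simp: append_eq_Cons_conv)
  then show "klin (\<lambda>x. F ((xs @ x # ys) ! 0) ((xs @ x # ys) ! 1) ((xs @ x # ys) ! 2))"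
    by cases (use assms in \<open>simp_all add: trilin_def\<close>)
qed

lemma multilinear4:
  assumes "quadrilin F"
  shows "multilinear 4 (\<lambda>xs. F (xs ! 0) (xs ! 1) (xs ! 2) (xs ! 3))"
  unfolding multilinear_def
proof (intro allI impI)
  fix xs ys :: "'a list" assume "length xs + length ys + 1 = 4"
  then have "length xs + length ys = 3" by simp
  then consider a b c where "xs = []" "ys = [a, b, c]" | a b c where "xs = [a]" "ys = [b, c]"
    | a b c where "xs = [a, b]" "ys = [c]" | a b c where "xs = [a, b, c]" "ys = []"
    using list_of_length3[of "xs @ ys"] by (auto simp: append_eq_Cons_conv)
  then show "klin (\<lambda>x. F ((xs @ x # ys) ! 0) ((xs @ x # ys) ! 1) ((xs @ x # ys) ! 2) ((xs @ x # ys) ! 3))"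
    by cases (use assms in \<open>simp_all add: quadrilin_def eval_nat_numeral\<close>)
qed

lemma contract2_tmult:
  assumes "bilin F" "X \<in> tpower 2" "Y \<in> tpower 2"
  shows "contract2 F (X \<odot>\<^bsub>2\<^esub> Y) =
    contract2 (\<lambda>x y. contract2 (\<lambda>x' y'. F (x * x') (y * y')) Y) X"
  unfolding contract_tsum tsum_tmult[OF multilinear2[OF assms(1)] assms(2,3)]
  by (intro tsum_cong[OF assms(2)] tsum_cong[OF assms(3)]) simp

lemma contract3_tmult:
  assumes "trilin F" "X \<in> tpower 3" "Y \<in> tpower 3"
  shows "contract3 F (X \<odot>\<^bsub>3\<^esub> Y) =
    contract3 (\<lambda>x y z. contract3 (\<lambda>x' y' z'. F (x * x') (y * y') (z * z')) Y) X"
  unfolding contract_tsum tsum_tmult[OF multilinear3[OF assms(1)] assms(2,3)]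
  by (intro tsum_cong[OF assms(2)] tsum_cong[OF assms(3)]) simp

lemma contract4_tmult:
  assumes "quadrilin F" "X \<in> tpower 4" "Y \<in> tpower 4"
  shows "contract4 F (X \<odot>\<^bsub>4\<^esub> Y) =
    contract4 (\<lambda>x y z t. contract4 (\<lambda>x' y' z' t'. F (x * x') (y * y') (z * z') (t * t')) Y) X"
  unfolding contract_tsum tsum_tmult[OF multilinear4[OF assms(1)] assms(2,3)]
  by (intro tsum_cong[OF assms(2)] tsum_cong[OF assms(3)]) simp

lemma contract2_tone: "bilin F \<Longrightarrow> contract2 F (tone 2) = F 1 1"
  unfolding contract_tsum by (subst tsum_tone[OF multilinear2]) simp_all

lemma contract3_tone: "trilin F \<Longrightarrow> contract3 F (tone 3) = F 1 1 1"
  unfolding contract_tsum by (subst tsum_tone[OF multilinear3]) simp_all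

lemma tensor3_eqI:
  assumes "X \<in> tpower 3" "Y \<in> tpower 3" "\<And>F. trilin F \<Longrightarrow> contract3 F X = contract3 F Y"
  shows "X = Y"
proof (rule tensor_eqI[OF assms(1,2)])
  fix G :: "'a list \<Rightarrow> 'a" assume G: "multilinear 3 G"
  have ix: "klin (\<lambda>x. G (us @ x # vs))" if "length us + length vs = 2" for us vs
    using G that by (simp add: multilinear_def)
  have "trilin (\<lambda>x y z. G [x, y, z])"
    by (intro trilinI) (use ix[of "[]" "[_, _]"] ix[of "[_]" "[_]"] ix[of "[_, _]" "[]"] in simp_all)
  from assms(3)[OF this]
  have "tsum (\<lambda>xs. G [xs ! 0, xs ! 1, xs ! 2]) X = tsum (\<lambda>xs. G [xs ! 0, xs ! 1, xs ! 2]) Y"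
    by (simp add: contract3_tsum)
  moreover have "tsum (\<lambda>xs. G [xs ! 0, xs ! 1, xs ! 2]) Z = tsum G Z" if "Z \<in> tpower 3" for Z
    by (rule tsum_cong[OF that]) (auto dest!: list_of_length3)
  ultimately show "tsum G X = tsum G Y" using assms(1,2) by simp
qed

lemma contract_is_tinv2:
  assumes "is_tinv 2 X Y" "X \<in> tpower 2" "bilin F"
  shows "contract2 (\<lambda>x y. contract2 (\<lambda>x' y'. F (x * x') (y * y')) Y) X = F 1 1"
    "contract2 (\<lambda>x y. contract2 (\<lambda>x' y'. F (x * x') (y * y')) X) Y = F 1 1"
  using assms contract2_tmult[OF assms(3), of X Y] contract2_tmult[OF assms(3), of Y X]
    contract2_tone[OF assms(3)]
  by (simp_all add: is_tinv_def)

lemma contract_is_tinv3: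
  assumes "is_tinv 3 X Y" "X \<in> tpower 3" "trilin F"
  shows "contract3 (\<lambda>x y z. contract3 (\<lambda>x' y' z'. F (x * x') (y * y') (z * z')) Y) X = F 1 1 1"
    "contract3 (\<lambda>x y z. contract3 (\<lambda>x' y' z'. F (x * x') (y * y') (z * z')) X) Y = F 1 1 1"
  using assms contract3_tmult[OF assms(3), of X Y] contract3_tmult[OF assms(3), of Y X]
    contract3_tone[OF assms(3)]
  by (simp_all add: is_tinv_def)

lemma is_tinv3I:
  assumes X: "X \<in> tpower 3" and Y: "Y \<in> tpower 3"
    and "\<And>F. trilin F \<Longrightarrow>
      contract3 (\<lambda>x y z. contract3 (\<lambda>x' y' z'. F (x * x') (y * y') (z * z')) Y) X = F 1 1 1"
    and "\<And>F. trilin F \<Longrightarrow>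
      contract3 (\<lambda>x y z. contract3 (\<lambda>x' y' z'. F (x * x') (y * y') (z * z')) X) Y = F 1 1 1"
  shows "is_tinv 3 X Y"
  unfolding is_tinv_def
  by (intro conjI Y tensor3_eqI tmult_in_tpower tone_in_tpower X)
    (simp_all add: contract3_tmult X Y assms(3,4) contract3_tone)

lemma contract3_tmap_pure:
  assumes "trilin F" "X \<in> tpower m" "\<And>xs. length xs = m \<Longrightarrow> length (f xs) = 3"
  shows "contract3 F (tmap 3 (\<lambda>xs. pure (f xs)) X) = tsum (\<lambda>xs. F (f xs ! 0) (f xs ! 1) (f xs ! 2)) X"
  unfolding contract_tsum by (rule tsum_tmap_pure[OF multilinear3[OF assms(1)] assms(2,3)])

lemma tensor3_perm:
  assumes "X \<in> tpower 3"
  shows "tmap 3 (\<lambda>xs. pure [xs ! i, xs ! j, xs ! k]) X \<in> tpower 3"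
  by (intro tmap_in_tpower[OF assms] pure_formals) simp

lemma contract3_perm:
  assumes "trilin F" "X \<in> tpower 3"
  shows "contract3 F (tmap 3 (\<lambda>xs. pure [xs ! 1, xs ! 2, xs ! 0]) X) = contract3 (\<lambda>x y z. F y z x) X"
    "contract3 F (tmap 3 (\<lambda>xs. pure [xs ! 0, xs ! 2, xs ! 1]) X) = contract3 (\<lambda>x y z. F x z y) X"
    "contract3 F (tmap 3 (\<lambda>xs. pure [xs ! 2, xs ! 0, xs ! 1]) X) = contract3 (\<lambda>x y z. F z x y) X"
    "contract3 F (tmap 3 (\<lambda>xs. pure [xs ! 1, xs ! 0, xs ! 2]) X) = contract3 (\<lambda>x y z. F y x z) X"
  by (subst contract3_tmap_pure[OF assms]; simp add: contract3_tsum)+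

text \<open>
  A permutation of the legs is multiplicative. In sums this is visible directly: it permutes the
  arguments of the integrand, and the inverse property holds for all trilinear integrands.
\<close>
lemma tinv_perm:
  assumes X: "tunit 3 X"
  shows "tinv 3 (tmap 3 (\<lambda>xs. pure [xs ! 1, xs ! 2, xs ! 0]) X) =
      tmap 3 (\<lambda>xs. pure [xs ! 1, xs ! 2, xs ! 0]) (tinv 3 X)"
    "tinv 3 (tmap 3 (\<lambda>xs. pure [xs ! 1, xs ! 0, xs ! 2]) X) =
      tmap 3 (\<lambda>xs. pure [xs ! 1, xs ! 0, xs ! 2]) (tinv 3 X)"
proof -
  have inv: "is_tinv 3 X (tinv 3 X)" using X by (rule is_tinv_tinv)
  have mem: "X \<in> tpower 3" "tinv 3 X \<in> tpower 3"
    using X inv by (auto simp: tunit_def is_tinv_def)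
  show "tinv 3 (tmap 3 (\<lambda>xs. pure [xs ! 1, xs ! 2, xs ! 0]) X) = tmap 3 (\<lambda>xs. pure [xs ! 1, xs ! 2, xs ! 0]) (tinv 3 X)"
  proof (intro tinv_eqI is_tinv3I tensor3_perm mem)
    fix F assume F: "trilin F"
    note lin = trilinI klin_intros trilin_comp[OF F]
    have F': "trilin (\<lambda>x y z. F y z x)" by (intro lin)
    have "trilin (\<lambda>x' y' z'. F (x * x') (y * y') (z * z'))" for x y z by (intro lin)
    moreover have "trilin (\<lambda>x y z. contract3 (\<lambda>x' y' z'. F (x * y') (y * z') (z * x')) Z)" for Z
      by (intro lin)
    ultimately have "contract3 (\<lambda>x y z. contract3 (\<lambda>x' y' z'. F (x * x') (y * y') (z * z'))
          (tmap 3 (\<lambda>xs. pure [xs ! 1, xs ! 2, xs ! 0]) Y)) (tmap 3 (\<lambda>xs. pure [xs ! 1, xs ! 2, xs ! 0]) Z) =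
        contract3 (\<lambda>x y z. contract3 (\<lambda>x' y' z'. F (y * y') (z * z') (x * x')) Y) Z"
      if "Y \<in> tpower 3" "Z \<in> tpower 3" for Y Z
      using that by (simp add: contract3_perm del: One_nat_def)
    then show "contract3 (\<lambda>x y z. contract3 (\<lambda>x' y' z'. F (x * x') (y * y') (z * z'))
          (tmap 3 (\<lambda>xs. pure [xs ! 1, xs ! 2, xs ! 0]) (tinv 3 X))) (tmap 3 (\<lambda>xs. pure [xs ! 1, xs ! 2, xs ! 0]) X) = F 1 1 1"
        "contract3 (\<lambda>x y z. contract3 (\<lambda>x' y' z'. F (x * x') (y * y') (z * z'))
          (tmap 3 (\<lambda>xs. pure [xs ! 1, xs ! 2, xs ! 0]) X)) (tmap 3 (\<lambda>xs. pure [xs ! 1, xs ! 2, xs ! 0]) (tinv 3 X)) = F 1 1 1"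
      using contract_is_tinv3[OF inv mem(1) F'] mem by simp_all
  qed
  show "tinv 3 (tmap 3 (\<lambda>xs. pure [xs ! 1, xs ! 0, xs ! 2]) X) = tmap 3 (\<lambda>xs. pure [xs ! 1, xs ! 0, xs ! 2]) (tinv 3 X)"
  proof (intro tinv_eqI is_tinv3I tensor3_perm mem)
    fix F assume F: "trilin F"
    note lin = trilinI klin_intros trilin_comp[OF F]
    have F': "trilin (\<lambda>x y z. F y x z)" by (intro lin)
    have "trilin (\<lambda>x' y' z'. F (x * x') (y * y') (z * z'))" for x y z by (intro lin)
    moreover have "trilin (\<lambda>x y z. contract3 (\<lambda>x' y' z'. F (x * y') (y * x') (z * z')) Z)" for Z
      by (intro lin)
    ultimately have "contract3 (\<lambda>x y z. contract3 (\<lambda>x' y' z'. F (x * x') (y * y') (z * z'))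
          (tmap 3 (\<lambda>xs. pure [xs ! 1, xs ! 0, xs ! 2]) Y)) (tmap 3 (\<lambda>xs. pure [xs ! 1, xs ! 0, xs ! 2]) Z) =
        contract3 (\<lambda>x y z. contract3 (\<lambda>x' y' z'. F (y * y') (x * x') (z * z')) Y) Z"
      if "Y \<in> tpower 3" "Z \<in> tpower 3" for Y Z
      using that by (simp add: contract3_perm del: One_nat_def)
    then show "contract3 (\<lambda>x y z. contract3 (\<lambda>x' y' z'. F (x * x') (y * y') (z * z'))
          (tmap 3 (\<lambda>xs. pure [xs ! 1, xs ! 0, xs ! 2]) (tinv 3 X))) (tmap 3 (\<lambda>xs. pure [xs ! 1, xs ! 0, xs ! 2]) X) = F 1 1 1"
        "contract3 (\<lambda>x y z. contract3 (\<lambda>x' y' z'. F (x * x') (y * y') (z * z'))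
          (tmap 3 (\<lambda>xs. pure [xs ! 1, xs ! 0, xs ! 2]) X)) (tmap 3 (\<lambda>xs. pure [xs ! 1, xs ! 0, xs ! 2]) (tinv 3 X)) = F 1 1 1"
      using contract_is_tinv3[OF inv mem(1) F'] mem by simp_all
  qed
qed

lemma contract2_scale: "contract2 (\<lambda>x y. c *s F x y) X = c *s contract2 F X"
  using klin_of_contract2[OF klin_scale[OF klin_id], of c F X] by simp

lemma contract3_scale: "contract3 (\<lambda>x y z. c *s F x y z) X = c *s contract3 F X"
  using klin_of_contract3[OF klin_scale[OF klin_id], of c F X] by simp

lemmas lin_intros = bilinI trilinI quadrilinI klin_intros

lemma contract3_tmult5:
  assumes G: "trilin G"
    and "A \<in> tpower 3" "B \<in> tpower 3" "C \<in> tpower 3" "D \<in> tpower 3" "E \<in> tpower 3"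
  shows "contract3 G (A \<odot>\<^bsub>3\<^esub> B \<odot>\<^bsub>3\<^esub> C \<odot>\<^bsub>3\<^esub> D \<odot>\<^bsub>3\<^esub> E) =
    contract3 (\<lambda>a1 a2 a3. contract3 (\<lambda>b1 b2 b3. contract3 (\<lambda>c1 c2 c3. contract3 (\<lambda>d1 d2 d3.
      contract3 (\<lambda>e1 e2 e3. G (a1 * b1 * c1 * d1 * e1) (a2 * b2 * c2 * d2 * e2)
        (a3 * b3 * c3 * d3 * e3)) E) D) C) B) A"
proof -
  note lin = lin_intros trilin_comp[OF G]
  note mem = assms(2-6) tmult_in_tpower
  have "contract3 G (A \<odot>\<^bsub>3\<^esub> B \<odot>\<^bsub>3\<^esub> C \<odot>\<^bsub>3\<^esub> D \<odot>\<^bsub>3\<^esub> E) =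
     contract3 (\<lambda>x y z. contract3 (\<lambda>e1 e2 e3. G (x * e1) (y * e2) (z * e3)) E)
       (A \<odot>\<^bsub>3\<^esub> B \<odot>\<^bsub>3\<^esub> C \<odot>\<^bsub>3\<^esub> D)"
    by (intro contract3_tmult G mem)
  also have "\<dots> = contract3 (\<lambda>x y z. contract3 (\<lambda>d1 d2 d3. contract3 (\<lambda>e1 e2 e3.
      G (x * d1 * e1) (y * d2 * e2) (z * d3 * e3)) E) D) (A \<odot>\<^bsub>3\<^esub> B \<odot>\<^bsub>3\<^esub> C)"
    by (intro contract3_tmult mem) (intro lin)
  also have "\<dots> = contract3 (\<lambda>x y z. contract3 (\<lambda>c1 c2 c3. contract3 (\<lambda>d1 d2 d3.
      contract3 (\<lambda>e1 e2 e3. G (x * c1 * d1 * e1) (y * c2 * d2 * e2) (z * c3 * d3 * e3)) E) D) C)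
      (A \<odot>\<^bsub>3\<^esub> B)"
    by (intro contract3_tmult mem) (intro lin)
  also have "\<dots> = contract3 (\<lambda>a1 a2 a3. contract3 (\<lambda>b1 b2 b3. contract3 (\<lambda>c1 c2 c3. contract3 (\<lambda>d1 d2 d3.
      contract3 (\<lambda>e1 e2 e3. G (a1 * b1 * c1 * d1 * e1) (a2 * b2 * c2 * d2 * e2)
        (a3 * b3 * c3 * d3 * e3)) E) D) C) B) A"
    by (intro contract3_tmult mem) (intro lin)
  finally show ?thesis .
qed

lemma contract3_embed:
  assumes G: "trilin G" and X: "X \<in> tpower 2"
  shows "contract3 G (tmap 3 (\<lambda>xs. pure [xs ! 0, xs ! 1, 1]) X) = contract2 (\<lambda>x y. G x y 1) X"
    "contract3 G (tmap 3 (\<lambda>xs. pure [xs ! 0, 1, xs ! 1]) X) = contract2 (\<lambda>x y. G x 1 y) X"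
    "contract3 G (tmap 3 (\<lambda>xs. pure [1, xs ! 0, xs ! 1]) X) = contract2 (\<lambda>x y. G 1 x y) X"
  by (subst contract3_tmap_pure[OF assms]; simp add: contract2_tsum)+

end

section \<open>The axioms of a quasi-bialgebra as identities of sums\<close>

context quasi_bialgebra
begin

abbreviation "\<Psi> \<equiv> tinv 3 \<Phi>"

lemma assoc_closed: "\<Phi> \<in> tpower 3" "\<Psi> \<in> tpower 3" and assoc_is_tinv: "is_tinv 3 \<Phi> \<Psi>"
  using assoc_unit is_tinv_tinv[OF assoc_unit] by (auto simp: tunit_def is_tinv_def)

lemma counit_mult_scale: "\<epsilon> (a * b) *s v = \<epsilon> a *s \<epsilon> b *s v"
  by (simp add: counit_mult)

lemma klin_counit: "klin f \<Longrightarrow> klin (\<lambda>x. \<epsilon> (f x) *s b)"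
proof -
  interpret \<epsilon>: Vector_Spaces.linear scale "(*)" \<epsilon> by (rule counit_linear)
  assume "klin f"
  then show ?thesis
    by (simp add: klin_def \<epsilon>.add \<epsilon>.scale scale_left_distrib)
qed

lemma klin_comult:
  assumes "klin f" "bilin G"
  shows "klin (\<lambda>a. contract2 G (\<Delta> (f a)))"
  using assms(1) multilinear2[OF assms(2)]
  by (simp add: klin_def comult_add comult_scale contract2_tsum tsum_tplus tsum_tscale comult_closed)

lemmas lins = lin_intros klin_counit klin_comult

lemma contract_comult_one: "bilin F \<Longrightarrow> contract2 F (\<Delta> 1) = F 1 1"
  by (simp add: comult_one contract2_tone)

lemma contract_counit_left:
  assumes "klin L"
  shows "contract2 (\<lambda>x y. \<epsilon> x *s L y) (\<Delta> a) = L a"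
  using klin_of_contract2[OF assms, of "\<lambda>x y. \<epsilon> x *s y" "\<Delta> a"] assms
  by (simp add: counit_left klin_def)

lemma contract_counit_right:
  assumes "klin L"
  shows "contract2 (\<lambda>x y. \<epsilon> y *s L x) (\<Delta> a) = L a"
  using klin_of_contract2[OF assms, of "\<lambda>x y. \<epsilon> y *s x" "\<Delta> a"] assms
  by (simp add: counit_right klin_def)

lemmas contract_assoc_inverse = contract_is_tinv3[OF assoc_is_tinv assoc_closed(1)]

lemma contract3_legs:
  assumes F: "trilin F" and X: "X \<in> tpower 2"
  shows "contract3 F (map_leg \<Delta> 3 0 X) = contract2 (\<lambda>x y. contract2 (\<lambda>x1 x2. F x1 x2 y) (\<Delta> x)) X"
    "contract3 F (map_leg \<Delta> 3 1 X) = contract2 (\<lambda>x y. contract2 (\<lambda>y1 y2. F x y1 y2) (\<Delta> y)) X"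
proof -
  note leg = tsum_map_leg[OF multilinear3[OF F] comult_closed X]
  show "contract3 F (map_leg \<Delta> 3 0 X) = contract2 (\<lambda>x y. contract2 (\<lambda>x1 x2. F x1 x2 y) (\<Delta> x)) X"
    unfolding contract_tsum
    by (subst leg, simp, simp, intro tsum_cong[OF X] tsum_cong[OF comult_closed])
      (auto dest!: list_of_length2)
  show "contract3 F (map_leg \<Delta> 3 1 X) = contract2 (\<lambda>x y. contract2 (\<lambda>y1 y2. F x y1 y2) (\<Delta> y)) X"
    unfolding contract_tsum
    by (subst leg, simp, simp, intro tsum_cong[OF X] tsum_cong[OF comult_closed])
      (auto dest!: list_of_length2)
qed

lemma contract4_legs:
  assumes F: "quadrilin F" and X: "X \<in> tpower 3"
  shows "contract4 F (map_leg \<Delta> 4 0 X) =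
      contract3 (\<lambda>x y z. contract2 (\<lambda>x1 x2. F x1 x2 y z) (\<Delta> x)) X"
    "contract4 F (map_leg \<Delta> 4 1 X) =
      contract3 (\<lambda>x y z. contract2 (\<lambda>y1 y2. F x y1 y2 z) (\<Delta> y)) X"
    "contract4 F (map_leg \<Delta> 4 2 X) =
      contract3 (\<lambda>x y z. contract2 (\<lambda>z1 z2. F x y z1 z2) (\<Delta> z)) X"
    "contract4 F (tmap 4 (\<lambda>xs. pure (xs @ [1])) X) = contract3 (\<lambda>x y z. F x y z 1) X"
    "contract4 F (tmap 4 (\<lambda>xs. pure (1 # xs)) X) = contract3 (\<lambda>x y z. F 1 x y z) X"
proof -
  note leg = tsum_map_leg[OF multilinear4[OF F] comult_closed X]
  show "contract4 F (map_leg \<Delta> 4 0 X) =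
      contract3 (\<lambda>x y z. contract2 (\<lambda>x1 x2. F x1 x2 y z) (\<Delta> x)) X"
    unfolding contract_tsum
    by (subst leg, simp, simp, intro tsum_cong[OF X] tsum_cong[OF comult_closed])
      (auto dest!: list_of_length2 list_of_length3)
  show "contract4 F (map_leg \<Delta> 4 1 X) =
      contract3 (\<lambda>x y z. contract2 (\<lambda>y1 y2. F x y1 y2 z) (\<Delta> y)) X"
    unfolding contract_tsum
    by (subst leg, simp, simp, intro tsum_cong[OF X] tsum_cong[OF comult_closed])
      (auto dest!: list_of_length2 list_of_length3)
  show "contract4 F (map_leg \<Delta> 4 2 X) =
      contract3 (\<lambda>x y z. contract2 (\<lambda>z1 z2. F x y z1 z2) (\<Delta> z)) X"
    unfolding contract_tsum
    by (subst leg, simp, simp, intro tsum_cong[OF X] tsum_cong[OF comult_closed])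
      (auto dest!: list_of_length2 list_of_length3)
  note emb = tsum_tmap_pure[OF multilinear4[OF F] X]
  show "contract4 F (tmap 4 (\<lambda>xs. pure (xs @ [1])) X) = contract3 (\<lambda>x y z. F x y z 1) X"
    unfolding contract_tsum
    by (subst emb, simp, intro tsum_cong[OF X]) (auto dest!: list_of_length3)
  show "contract4 F (tmap 4 (\<lambda>xs. pure (1 # xs)) X) = contract3 (\<lambda>x y z. F 1 x y z) X"
    unfolding contract_tsum
    by (subst emb, simp, intro tsum_cong[OF X]) (auto dest!: list_of_length3)
qed

lemma map_leg_closed:
  "X \<in> tpower 2 \<Longrightarrow> i < 2 \<Longrightarrow> map_leg \<Delta> 3 i X \<in> tpower 3"
  "X \<in> tpower 3 \<Longrightarrow> i < 3 \<Longrightarrow> map_leg \<Delta> 4 i X \<in> tpower 4"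
  using map_leg_in_tpower[of \<Delta> X 2 3 i, OF comult_closed]
    map_leg_in_tpower[of \<Delta> X 3 4 i, OF comult_closed] by simp_all

text \<open>
  The quasi-coassociativity axiom, multiplied by \<open>\<Phi>\<close> from the left.
\<close>
lemma coassoc_contract:
  assumes F: "trilin F"
  shows "contract3 (\<lambda>x y z. contract2 (\<lambda>p q. contract2 (\<lambda>q1 q2. F (x * p) (y * q1) (z * q2))
      (\<Delta> q)) (\<Delta> a)) \<Phi> =
    contract2 (\<lambda>p q. contract2 (\<lambda>p1 p2. contract3 (\<lambda>x y z. F (p1 * x) (p2 * y) (q * z)) \<Phi>)
      (\<Delta> p)) (\<Delta> a)"
proof -
  let ?L = "map_leg \<Delta> 3 0 (\<Delta> a)" and ?M = "map_leg \<Delta> 3 1 (\<Delta> a)"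
  note lin = lins trilin_comp[OF F]
  have mem: "?L \<in> tpower 3" "?M \<in> tpower 3"
    by (simp_all add: map_leg_closed comult_closed)
  have "\<Phi> \<odot>\<^bsub>3\<^esub> ?M = \<Phi> \<odot>\<^bsub>3\<^esub> (\<Psi> \<odot>\<^bsub>3\<^esub> (?L \<odot>\<^bsub>3\<^esub> \<Phi>))"
    by (simp add: quasi_coassoc tmult_assoc mem assoc_closed del: One_nat_def)
  also have "\<dots> = (\<Phi> \<odot>\<^bsub>3\<^esub> \<Psi>) \<odot>\<^bsub>3\<^esub> (?L \<odot>\<^bsub>3\<^esub> \<Phi>)"
    by (intro tmult_assoc[symmetric] tmult_in_tpower mem assoc_closed)
  also have "\<dots> = ?L \<odot>\<^bsub>3\<^esub> \<Phi>"
    using assoc_is_tinv by (simp add: is_tinv_def tmult_tone_left tmult_in_tpower mem assoc_closed)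
  finally have "contract3 F (\<Phi> \<odot>\<^bsub>3\<^esub> ?M) = contract3 F (?L \<odot>\<^bsub>3\<^esub> \<Phi>)" by simp
  moreover have "contract3 F (\<Phi> \<odot>\<^bsub>3\<^esub> ?M) =
      contract3 (\<lambda>x y z. contract3 (\<lambda>x' y' z'. F (x * x') (y * y') (z * z')) ?M) \<Phi>"
    by (intro contract3_tmult F assoc_closed mem)
  moreover have "\<dots> = contract3 (\<lambda>x y z. contract2 (\<lambda>p q. contract2 (\<lambda>q1 q2. F (x * p) (y * q1) (z * q2))
      (\<Delta> q)) (\<Delta> a)) \<Phi>"
    by (subst contract3_legs, intro lin, rule comult_closed, rule refl)
  moreover have "contract3 F (?L \<odot>\<^bsub>3\<^esub> \<Phi>) =
      contract3 (\<lambda>x y z. contract3 (\<lambda>x' y' z'. F (x * x') (y * y') (z * z')) \<Phi>) ?L"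
    by (intro contract3_tmult F assoc_closed mem)
  moreover have "\<dots> = contract2 (\<lambda>p q. contract2 (\<lambda>p1 p2. contract3 (\<lambda>x y z. F (p1 * x) (p2 * y) (q * z)) \<Phi>)
      (\<Delta> p)) (\<Delta> a)"
    by (subst contract3_legs, intro lin, rule comult_closed, rule refl)
  ultimately show ?thesis by simp
qed

lemma pentagon_contract:
  assumes F: "quadrilin F"
  shows "contract3 (\<lambda>x y z. contract2 (\<lambda>x1 x2. contract3 (\<lambda>x' y' z'. contract2 (\<lambda>z1 z2.
      F (x1 * x') (x2 * y') (y * z1) (z * z2)) (\<Delta> z')) \<Phi>) (\<Delta> x)) \<Phi> =
    contract3 (\<lambda>x y z. contract3 (\<lambda>x' y' z'. contract2 (\<lambda>y1 y2. contract3 (\<lambda>x'' y'' z''.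
      F (x * x') (y * y1 * x'') (z * y2 * y'') (z' * z'')) \<Phi>) (\<Delta> y')) \<Phi>) \<Phi>"
proof -
  note lin = lins quadrilin_comp[OF F]
  let ?A = "tmap 4 (\<lambda>xs. pure (xs @ [1])) \<Phi>" and ?C = "tmap 4 (\<lambda>xs. pure (1 # xs)) \<Phi>"
  let ?B = "\<lambda>i. map_leg \<Delta> 4 i \<Phi>"
  have mem: "?A \<in> tpower 4" "?C \<in> tpower 4" "?B 0 \<in> tpower 4" "?B 1 \<in> tpower 4" "?B 2 \<in> tpower 4"
    by (simp_all add: map_leg_closed assoc_closed tmap_in_tpower[OF assoc_closed(1)] pure_formals)
  have "contract4 F (?B 0 \<odot>\<^bsub>4\<^esub> ?B 2) =
      contract4 (\<lambda>x y z t. contract4 (\<lambda>x' y' z' t'. F (x * x') (y * y') (z * z') (t * t')) (?B 2)) (?B 0)"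
    by (intro contract4_tmult F mem)
  also have "\<dots> = contract4 (\<lambda>x y z t. contract3 (\<lambda>x' y' z'. contract2 (\<lambda>z1 z2.
      F (x * x') (y * y') (z * z1) (t * z2)) (\<Delta> z')) \<Phi>) (?B 0)"
    by (subst contract4_legs(3), intro lin, rule assoc_closed, rule refl)
  also have "\<dots> = contract3 (\<lambda>x y z. contract2 (\<lambda>x1 x2. contract3 (\<lambda>x' y' z'. contract2 (\<lambda>z1 z2.
      F (x1 * x') (x2 * y') (y * z1) (z * z2)) (\<Delta> z')) \<Phi>) (\<Delta> x)) \<Phi>"
    by (subst contract4_legs(1), intro lin, rule assoc_closed, rule refl)
  finally have left: "contract4 F (?B 0 \<odot>\<^bsub>4\<^esub> ?B 2) = \<dots>" .
  have "contract4 F (?A \<odot>\<^bsub>4\<^esub> ?B 1 \<odot>\<^bsub>4\<^esub> ?C) =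
      contract4 (\<lambda>x y z t. contract4 (\<lambda>x' y' z' t'. F (x * x') (y * y') (z * z') (t * t')) ?C) (?A \<odot>\<^bsub>4\<^esub> ?B 1)"
    by (intro contract4_tmult tmult_in_tpower F mem)
  also have "\<dots> = contract4 (\<lambda>x y z t. contract3 (\<lambda>x'' y'' z''. F (x * 1) (y * x'') (z * y'') (t * z'')) \<Phi>)
      (?A \<odot>\<^bsub>4\<^esub> ?B 1)"
    by (subst contract4_legs(5), intro lin, rule assoc_closed, rule refl)
  also have "\<dots> = contract4 (\<lambda>x y z t. contract4 (\<lambda>x' y' z' t'. contract3 (\<lambda>x'' y'' z''.
      F (x * x' * 1) (y * y' * x'') (z * z' * y'') (t * t' * z'')) \<Phi>) (?B 1)) ?A"
    by (subst contract4_tmult, intro lin, rule mem, rule mem, rule refl)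
  also have "\<dots> = contract4 (\<lambda>x y z t. contract3 (\<lambda>x' y' z'. contract2 (\<lambda>y1 y2. contract3 (\<lambda>x'' y'' z''.
      F (x * x' * 1) (y * y1 * x'') (z * y2 * y'') (t * z' * z'')) \<Phi>) (\<Delta> y')) \<Phi>) ?A"
    by (subst contract4_legs(2), intro lin, rule assoc_closed, rule refl)
  also have "\<dots> = contract3 (\<lambda>x y z. contract3 (\<lambda>x' y' z'. contract2 (\<lambda>y1 y2. contract3 (\<lambda>x'' y'' z''.
      F (x * x' * 1) (y * y1 * x'') (z * y2 * y'') (1 * z' * z'')) \<Phi>) (\<Delta> y')) \<Phi>) \<Phi>"
    by (subst contract4_legs(4), intro lin, rule assoc_closed, rule refl)
  finally show ?thesis using left pentagon by simp
qed

lemma counit_assoc_mid: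
  assumes B: "bilin B"
  shows "contract3 (\<lambda>x y z. \<epsilon> y *s B x z) \<Phi> = B 1 1"
proof -
  have "fscale c (pure [x, y]) \<in> formals 2" for c :: 'k and x y :: 'a
    by (auto simp: formals_def pure_def in_keys_iff lookup_fscale lookup_single when_def
        split: if_splits)
  then have "contract2 B (tmap 2 (\<lambda>xs. fscale (\<epsilon> (xs ! 1)) (pure [xs ! 0, xs ! 2])) \<Phi>) =
      contract3 (\<lambda>x y z. \<epsilon> y *s B x z) \<Phi>"
    unfolding contract_tsum
    by (subst tsum_tmap[OF multilinear2[OF B] assoc_closed(1)])
      (simp_all add: linext_fscale linext_pure)
  then show ?thesis by (simp only: counit_assoc contract2_tone[OF B])
qed

lemma contract_assoc_cancel:
  assumes "trilin F"
  shows "contract3 (\<lambda>x y z. contract3 (\<lambda>x' y' z'. F (x * x') (y * y') (z * z')) \<Psi>) \<Phi> = F 1 1 1"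
    "contract3 (\<lambda>x y z. contract3 (\<lambda>x' y' z'. F (x * x') (y * y') (z * z')) \<Phi>) \<Psi> = F 1 1 1"
    "contract3 (\<lambda>x y z. contract3 (\<lambda>x' y' z'. F (x' * x) (y' * y) (z' * z)) \<Psi>) \<Phi> = F 1 1 1"
  using contract_assoc_inverse[OF assms] by (auto simp: contract_swap33[of _ \<Phi> \<Psi>])

text \<open>
  Applying the counit to the second leg of the pentagon leaves \<open>\<Phi>\<close> on the left and, on
  the right, \<open>\<Phi>\<close> times 1 \<open>\<otimes>\<close> \<open>\<phi>\<close>, where
  \<open>\<phi>\<close> is \<open>\<Phi>\<close> with the counit applied to its first leg. The integrand
  G carries a left factor \<open>\<Psi>\<close>, which cancels \<open>\<Phi>\<close>, and the counit on the
  first leg, which leaves \<open>\<phi>\<close> = 1.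
\<close>
lemma counit_assoc_left:
  assumes B: "bilin B"
  shows "contract3 (\<lambda>x y z. \<epsilon> x *s B y z) \<Phi> = B 1 1"
proof -
  define G where "G a c d = contract3 (\<lambda>x y z. \<epsilon> (x * a) *s B (y * c) (z * d)) \<Psi>" for a c d
  have "trilin G"
    unfolding G_def by (intro lins bilin_comp[OF B])
  note lin = lins bilin_comp[OF B] trilin_comp[OF this]
  have "contract3 (\<lambda>x y z. contract2 (\<lambda>x1 x2. contract3 (\<lambda>x' y' z'. contract2 (\<lambda>z1 z2.
        \<epsilon> (x2 * y') *s G (x1 * x') (y * z1) (z * z2)) (\<Delta> z')) \<Phi>) (\<Delta> x)) \<Phi> =
      contract3 (\<lambda>x y z. contract3 (\<lambda>x' y' z'. contract2 (\<lambda>y1 y2. contract3 (\<lambda>x'' y'' z''.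
        \<epsilon> (y * y1 * x'') *s G (x * x') (z * y2 * y'') (z' * z'')) \<Phi>) (\<Delta> y')) \<Phi>) \<Phi>"
    by (rule pentagon_contract[of "\<lambda>a b c d. \<epsilon> b *s G a c d"]) (intro lin)
  moreover have "contract3 (\<lambda>x y z. contract2 (\<lambda>x1 x2. contract3 (\<lambda>x' y' z'. contract2 (\<lambda>z1 z2.
        \<epsilon> (x2 * y') *s G (x1 * x') (y * z1) (z * z2)) (\<Delta> z')) \<Phi>) (\<Delta> x)) \<Phi> = B 1 1"
  proof -
    have "contract3 (\<lambda>x' y' z'. contract2 (\<lambda>z1 z2.
        \<epsilon> (x2 * y') *s G (x1 * x') (y * z1) (z * z2)) (\<Delta> z')) \<Phi> = \<epsilon> x2 *s G x1 y z" for x1 x2 y z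
    proof -
      have "contract3 (\<lambda>x' y' z'. contract2 (\<lambda>z1 z2.
          \<epsilon> (x2 * y') *s G (x1 * x') (y * z1) (z * z2)) (\<Delta> z')) \<Phi> =
        \<epsilon> x2 *s contract3 (\<lambda>x' y' z'. \<epsilon> y' *s contract2 (\<lambda>z1 z2.
          G (x1 * x') (y * z1) (z * z2)) (\<Delta> z')) \<Phi>"
        by (simp only: counit_mult_scale contract2_scale contract3_scale)
      also have "\<dots> = \<epsilon> x2 *s contract2 (\<lambda>z1 z2. G (x1 * 1) (y * z1) (z * z2)) (\<Delta> 1)"
        by (subst counit_assoc_mid, intro lin, rule refl)
      also have "\<dots> = \<epsilon> x2 *s G x1 y z"
        by (subst contract_comult_one, intro lin, simp)
      finally show ?thesis .
    qed
    moreover have "contract2 (\<lambda>x1 x2. \<epsilon> x2 *s G x1 y z) (\<Delta> x) = G x y z" for x y z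
      by (rule contract_counit_right) (intro lin)
    moreover have "contract3 G \<Phi> = B 1 1"
      unfolding G_def
      by (subst contract_assoc_cancel(3)[of "\<lambda>x y z. \<epsilon> x *s B y z"], intro lin, simp add: counit_one)
    ultimately show ?thesis by simp
  qed
  moreover have "contract3 (\<lambda>x y z. contract3 (\<lambda>x' y' z'. contract2 (\<lambda>y1 y2. contract3 (\<lambda>x'' y'' z''.
        \<epsilon> (y * y1 * x'') *s G (x * x') (z * y2 * y'') (z' * z'')) \<Phi>) (\<Delta> y')) \<Phi>) \<Phi> =
      contract3 (\<lambda>x y z. \<epsilon> x *s B y z) \<Phi>"
  proof -
    have "contract3 (\<lambda>x y z. contract3 (\<lambda>x' y' z'. contract2 (\<lambda>y1 y2. contract3 (\<lambda>x'' y'' z''.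
        \<epsilon> (y * y1 * x'') *s G (x * x') (z * y2 * y'') (z' * z'')) \<Phi>) (\<Delta> y')) \<Phi>) \<Phi> =
      contract3 (\<lambda>x y z. \<epsilon> y *s contract3 (\<lambda>x' y' z'. contract2 (\<lambda>y1 y2. \<epsilon> y1 *s contract3
        (\<lambda>x'' y'' z''. \<epsilon> x'' *s G (x * x') (z * y2 * y'') (z' * z'')) \<Phi>) (\<Delta> y')) \<Phi>) \<Phi>"
      by (simp only: counit_mult_scale contract2_scale contract3_scale)
    also have "\<dots> = contract3 (\<lambda>x' y' z'. contract2 (\<lambda>y1 y2. \<epsilon> y1 *s contract3
        (\<lambda>x'' y'' z''. \<epsilon> x'' *s G (1 * x') (1 * y2 * y'') (z' * z'')) \<Phi>) (\<Delta> y')) \<Phi>"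
      by (rule counit_assoc_mid) (intro lin)
    also have "\<dots> = contract3 (\<lambda>x' y' z'. contract3
        (\<lambda>x'' y'' z''. \<epsilon> x'' *s G (1 * x') (1 * y' * y'') (z' * z'')) \<Phi>) \<Phi>"
      by (subst contract_counit_left, intro lin, rule refl)
    also have "\<dots> = contract3 (\<lambda>x'' y'' z''. \<epsilon> x'' *s contract3
        (\<lambda>x' y' z'. G (1 * x') (1 * y' * y'') (z' * z'')) \<Phi>) \<Phi>"
      by (subst contract_swap33) (simp only: contract3_scale)
    also have "\<dots> = contract3 (\<lambda>x y z. \<epsilon> x *s B y z) \<Phi>"
    proof -
      have "contract3 (\<lambda>x' y' z'. G (1 * x') (1 * y' * y'') (z' * z'')) \<Phi> = B y'' z''" for y'' z''
      unfolding G_def using contract_assoc_cancel(3)[of "\<lambda>x y z. \<epsilon> x *s B (y * y'') (z * z'')"]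
        by (simp add: mult.assoc lin counit_one)
      then show ?thesis by (simp only:)
    qed
    finally show ?thesis .
  qed
  ultimately show ?thesis by simp
qed

text \<open>
  The mirror image: the counit is applied to the third leg of the pentagon, and \<open>\<Phi>\<close> is
  cancelled from the right.
\<close>
lemma counit_assoc_right:
  assumes B: "bilin B"
  shows "contract3 (\<lambda>x y z. \<epsilon> z *s B x y) \<Phi> = B 1 1"
proof -
  define G where "G a b d = contract3 (\<lambda>x y z. \<epsilon> (d * z) *s B (a * x) (b * y)) \<Psi>" for a b d
  have "trilin G"
    unfolding G_def by (intro lins bilin_comp[OF B])
  note lin = lins bilin_comp[OF B] trilin_comp[OF this]
  have "contract3 (\<lambda>x y z. contract2 (\<lambda>x1 x2. contract3 (\<lambda>x' y' z'. contract2 (\<lambda>z1 z2.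
        \<epsilon> (y * z1) *s G (x1 * x') (x2 * y') (z * z2)) (\<Delta> z')) \<Phi>) (\<Delta> x)) \<Phi> =
      contract3 (\<lambda>x y z. contract3 (\<lambda>x' y' z'. contract2 (\<lambda>y1 y2. contract3 (\<lambda>x'' y'' z''.
        \<epsilon> (z * y2 * y'') *s G (x * x') (y * y1 * x'') (z' * z'')) \<Phi>) (\<Delta> y')) \<Phi>) \<Phi>"
    by (rule pentagon_contract[of "\<lambda>a b c d. \<epsilon> c *s G a b d"]) (intro lin)
  moreover have "contract3 (\<lambda>x y z. contract2 (\<lambda>x1 x2. contract3 (\<lambda>x' y' z'. contract2 (\<lambda>z1 z2.
        \<epsilon> (y * z1) *s G (x1 * x') (x2 * y') (z * z2)) (\<Delta> z')) \<Phi>) (\<Delta> x)) \<Phi> = B 1 1"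
  proof -
    have "contract3 (\<lambda>x y z. contract2 (\<lambda>x1 x2. contract3 (\<lambda>x' y' z'. contract2 (\<lambda>z1 z2.
        \<epsilon> (y * z1) *s G (x1 * x') (x2 * y') (z * z2)) (\<Delta> z')) \<Phi>) (\<Delta> x)) \<Phi> =
      contract3 (\<lambda>x y z. \<epsilon> y *s contract2 (\<lambda>x1 x2. contract3 (\<lambda>x' y' z'. contract2 (\<lambda>z1 z2.
        \<epsilon> z1 *s G (x1 * x') (x2 * y') (z * z2)) (\<Delta> z')) \<Phi>) (\<Delta> x)) \<Phi>"
      by (simp only: counit_mult_scale contract2_scale contract3_scale)
    also have "\<dots> = contract2 (\<lambda>x1 x2. contract3 (\<lambda>x' y' z'. contract2 (\<lambda>z1 z2.
        \<epsilon> z1 *s G (x1 * x') (x2 * y') (1 * z2)) (\<Delta> z')) \<Phi>) (\<Delta> 1)"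
      by (rule counit_assoc_mid) (intro lin)
    also have "\<dots> = contract3 (\<lambda>x' y' z'. contract2 (\<lambda>z1 z2.
        \<epsilon> z1 *s G (1 * x') (1 * y') (1 * z2)) (\<Delta> z')) \<Phi>"
      by (rule contract_comult_one) (intro lin)
    also have "\<dots> = contract3 G \<Phi>"
      by (subst contract_counit_left, intro lin, simp)
    also have "\<dots> = B 1 1"
      unfolding G_def
      by (subst contract_assoc_cancel(1)[of "\<lambda>x y z. \<epsilon> z *s B x y"], intro lin, simp add: counit_one)
    finally show ?thesis .
  qed
  moreover have "contract3 (\<lambda>x y z. contract3 (\<lambda>x' y' z'. contract2 (\<lambda>y1 y2. contract3 (\<lambda>x'' y'' z''.
        \<epsilon> (z * y2 * y'') *s G (x * x') (y * y1 * x'') (z' * z'')) \<Phi>) (\<Delta> y')) \<Phi>) \<Phi> =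
      contract3 (\<lambda>x y z. \<epsilon> z *s B x y) \<Phi>"
  proof -
    have "contract3 (\<lambda>x y z. contract3 (\<lambda>x' y' z'. contract2 (\<lambda>y1 y2. contract3 (\<lambda>x'' y'' z''.
        \<epsilon> (z * y2 * y'') *s G (x * x') (y * y1 * x'') (z' * z'')) \<Phi>) (\<Delta> y')) \<Phi>) \<Phi> =
      contract3 (\<lambda>x y z. \<epsilon> z *s contract3 (\<lambda>x' y' z'. contract2 (\<lambda>y1 y2. \<epsilon> y2 *s contract3
        (\<lambda>x'' y'' z''. \<epsilon> y'' *s G (x * x') (y * y1 * x'') (z' * z'')) \<Phi>) (\<Delta> y')) \<Phi>) \<Phi>"
      by (simp only: counit_mult_scale contract2_scale contract3_scale)
    also have "\<dots> = contract3 (\<lambda>x y z. \<epsilon> z *s contract3 (\<lambda>x' y' z'. contract2 (\<lambda>y1 y2.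
        \<epsilon> y2 *s G (x * x') (y * y1 * 1) (z' * 1)) (\<Delta> y')) \<Phi>) \<Phi>"
      by (subst counit_assoc_mid, intro lin, rule refl)
    also have "\<dots> = contract3 (\<lambda>x y z. \<epsilon> z *s contract3 (\<lambda>x' y' z'.
        G (x * x') (y * y' * 1) (z' * 1)) \<Phi>) \<Phi>"
      by (subst contract_counit_right, intro lin, rule refl)
    also have "\<dots> = contract3 (\<lambda>x y z. \<epsilon> z *s B x y) \<Phi>"
    proof -
      have "contract3 (\<lambda>x' y' z'. G (x * x') (y * y' * 1) (z' * 1)) \<Phi> = B x y" for x y
      unfolding G_def using contract_assoc_cancel(1)[of "\<lambda>a b c. \<epsilon> c *s B (x * a) (y * b)"]
        by (simp add: mult.assoc lin counit_one)
      then show ?thesis by (simp only:)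
    qed
    finally show ?thesis .
  qed
  ultimately show ?thesis by simp
qed

text \<open>
  The counit is multiplicative, so applying it to a leg of \<open>\<Phi>\<close> \<open>\<Psi>\<close> = 1
  leaves the corresponding identity for \<open>\<Psi>\<close>.
\<close>
lemma counit_assoc_inverse:
  assumes B: "bilin B"
  shows "contract3 (\<lambda>x y z. \<epsilon> x *s B y z) \<Psi> = B 1 1"
    "contract3 (\<lambda>x y z. \<epsilon> y *s B x z) \<Psi> = B 1 1"
    "contract3 (\<lambda>x y z. \<epsilon> z *s B x y) \<Psi> = B 1 1"
proof -
  note lin = lins bilin_comp[OF B]
  have "B 1 1 = contract3 (\<lambda>x y z. contract3 (\<lambda>x' y' z'. \<epsilon> (x * x') *s B (y * y') (z * z')) \<Psi>) \<Phi>"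
    by (subst contract_assoc_cancel(1)[of "\<lambda>x y z. \<epsilon> x *s B y z"], intro lin, simp add: counit_one)
  also have "\<dots> = contract3 (\<lambda>x y z. \<epsilon> x *s contract3 (\<lambda>x' y' z'. \<epsilon> x' *s B (y * y') (z * z')) \<Psi>) \<Phi>"
    by (simp only: counit_mult_scale contract3_scale)
  also have "\<dots> = contract3 (\<lambda>x y z. \<epsilon> x *s B y z) \<Psi>"
    by (subst counit_assoc_left, intro lin, simp)
  finally show "contract3 (\<lambda>x y z. \<epsilon> x *s B y z) \<Psi> = B 1 1" by simp
  have "B 1 1 = contract3 (\<lambda>x y z. contract3 (\<lambda>x' y' z'. \<epsilon> (y * y') *s B (x * x') (z * z')) \<Psi>) \<Phi>"
    by (subst contract_assoc_cancel(1)[of "\<lambda>x y z. \<epsilon> y *s B x z"], intro lin, simp add: counit_one)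
  also have "\<dots> = contract3 (\<lambda>x y z. \<epsilon> y *s contract3 (\<lambda>x' y' z'. \<epsilon> y' *s B (x * x') (z * z')) \<Psi>) \<Phi>"
    by (simp only: counit_mult_scale contract3_scale)
  also have "\<dots> = contract3 (\<lambda>x y z. \<epsilon> y *s B x z) \<Psi>"
    by (subst counit_assoc_mid, intro lin, simp)
  finally show "contract3 (\<lambda>x y z. \<epsilon> y *s B x z) \<Psi> = B 1 1" by simp
  have "B 1 1 = contract3 (\<lambda>x y z. contract3 (\<lambda>x' y' z'. \<epsilon> (z * z') *s B (x * x') (y * y')) \<Psi>) \<Phi>"
    by (subst contract_assoc_cancel(1)[of "\<lambda>x y z. \<epsilon> z *s B x y"], intro lin, simp add: counit_one)
  also have "\<dots> = contract3 (\<lambda>x y z. \<epsilon> z *s contract3 (\<lambda>x' y' z'. \<epsilon> z' *s B (x * x') (y * y')) \<Psi>) \<Phi>"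
    by (simp only: counit_mult_scale contract3_scale)
  also have "\<dots> = contract3 (\<lambda>x y z. \<epsilon> z *s B x y) \<Psi>"
    by (subst counit_assoc_right, intro lin, simp)
  finally show "contract3 (\<lambda>x y z. \<epsilon> z *s B x y) \<Psi> = B 1 1" by simp
qed

section \<open>Comparing two antipodes\<close>

text \<open>
  An antipode without the two normalization conditions that involve the associator; these enter the
  comparison separately, and one of them for each of two antipodes suffices for a one-sided inverse.
\<close>
definition quasi_antipode :: "('a \<Rightarrow> 'a) \<Rightarrow> 'a \<Rightarrow> 'a \<Rightarrow> bool" where
  "quasi_antipode T a b \<longleftrightarrow>
     klin T \<and> (\<forall>x y. T (x * y) = T y * T x) \<and> T 1 = 1 \<and>
     (\<forall>h. contract2 (\<lambda>x y. T x * a * y) (\<Delta> h) = \<epsilon> h *s a) \<and>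
     (\<forall>h. contract2 (\<lambda>x y. x * b * T y) (\<Delta> h) = \<epsilon> h *s b)"

text \<open>
  Drinfeld's conjugating element of two antipodes. It depends on one half of the data of each of them.
\<close>
definition intertwiner :: "('a \<Rightarrow> 'a) \<Rightarrow> 'a \<Rightarrow> ('a \<Rightarrow> 'a) \<Rightarrow> 'a \<Rightarrow> 'a" where
  "intertwiner T a T' b' = contract3 (\<lambda>x y z. T x * a * y * b' * T' z) \<Phi>"

lemma quasi_antipodeD:
  assumes "quasi_antipode T a b"
  shows "klin T" "T (x * y) = T y * T x" "T 1 = 1"
  using assms by (simp_all add: quasi_antipode_def)

lemma quasi_antipode_left:
  assumes "quasi_antipode T a b" "klin L"
  shows "contract2 (\<lambda>x y. L (T x * a * y)) (\<Delta> h) = \<epsilon> h *s L a"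
  using assms klin_of_contract2[OF assms(2), of "\<lambda>x y. T x * a * y" "\<Delta> h"]
  by (simp add: quasi_antipode_def klin_def)

lemma quasi_antipode_right:
  assumes "quasi_antipode T a b" "klin L"
  shows "contract2 (\<lambda>x y. L (x * b * T y)) (\<Delta> h) = \<epsilon> h *s L b"
  using assms klin_of_contract2[OF assms(2), of "\<lambda>x y. x * b * T y" "\<Delta> h"]
  by (simp add: quasi_antipode_def klin_def)

text \<open>
  The integrand F is applied to both sides of quasi-coassociativity. On the left the antipode identity
  of T' consumes the second of the two coproducts, on the right that of T does; the counit then
  removes the other coproduct, and h leaves the sum as T(h) or T'(h).
\<close>
lemma intertwiner_commute:
  assumes T: "quasi_antipode T a b" and T': "quasi_antipode T' a' b'"
  shows "T h * intertwiner T a T' b' = intertwiner T a T' b' * T' h"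
proof -
  note anti = quasi_antipodeD(2,3)[OF T] quasi_antipodeD(2,3)[OF T'] mult.assoc
  note lin = lins klin_comp[OF quasi_antipodeD(1)[OF T]] klin_comp[OF quasi_antipodeD(1)[OF T']]
  let ?F = "\<lambda>x y z. T x * a * y * b' * T' z"
  have "contract3 (\<lambda>x y z. contract2 (\<lambda>p q. contract2 (\<lambda>q1 q2. ?F (x * p) (y * q1) (z * q2))
      (\<Delta> q)) (\<Delta> h)) \<Phi> =
    contract3 (\<lambda>x y z. contract2 (\<lambda>p q. \<epsilon> q *s (T (x * p) * a * y * b' * T' z)) (\<Delta> h)) \<Phi>"
  proof -
    have "contract2 (\<lambda>q1 q2. ?F (x * p) (y * q1) (z * q2)) (\<Delta> q) =
        \<epsilon> q *s (T (x * p) * a * y * b' * T' z)" for x y z p q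
      using quasi_antipode_right[OF T', of "\<lambda>v. T (x * p) * a * y * v * T' z" q]
      by (simp add: anti lin)
    then show ?thesis by simp
  qed
  also have "\<dots> = contract3 (\<lambda>x y z. T (x * h) * a * y * b' * T' z) \<Phi>"
    by (subst contract_counit_right, intro lin, rule refl)
  also have "\<dots> = T h * intertwiner T a T' b'"
    using klin_of_contract3[of "\<lambda>v. T h * v" ?F \<Phi>] by (simp add: anti lin intertwiner_def)
  finally have left: "contract3 (\<lambda>x y z. contract2 (\<lambda>p q. contract2 (\<lambda>q1 q2. ?F (x * p) (y * q1) (z * q2))
      (\<Delta> q)) (\<Delta> h)) \<Phi> = T h * intertwiner T a T' b'" .
  have "contract2 (\<lambda>p q. contract2 (\<lambda>p1 p2. contract3 (\<lambda>x y z. ?F (p1 * x) (p2 * y) (q * z)) \<Phi>)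
      (\<Delta> p)) (\<Delta> h) =
    contract2 (\<lambda>p q. \<epsilon> p *s contract3 (\<lambda>x y z. T x * a * y * b' * T' (q * z)) \<Phi>) (\<Delta> h)"
  proof -
    have "contract2 (\<lambda>p1 p2. contract3 (\<lambda>x y z. ?F (p1 * x) (p2 * y) (q * z)) \<Phi>) (\<Delta> p) =
        \<epsilon> p *s contract3 (\<lambda>x y z. T x * a * y * b' * T' (q * z)) \<Phi>" for p q
      using quasi_antipode_left[OF T, of "\<lambda>v. contract3 (\<lambda>x y z. T x * v * y * b' * T' (q * z)) \<Phi>" p]
      by (simp add: anti lin)
    then show ?thesis by simp
  qed
  also have "\<dots> = contract3 (\<lambda>x y z. T x * a * y * b' * T' (h * z)) \<Phi>"
    by (rule contract_counit_left) (intro lin)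
  also have "\<dots> = intertwiner T a T' b' * T' h"
    using klin_of_contract3[of "\<lambda>v. v * T' h" ?F \<Phi>] by (simp add: anti lin intertwiner_def)
  finally show ?thesis
    using coassoc_contract[of ?F h] left by (simp add: lin)
qed

text \<open>
  The pentagon, with its first factor \<open>\<Phi>\<close> \<open>\<otimes>\<close> 1 moved to the
  other side, expresses (1 \<open>\<otimes>\<close> \<open>\<Delta>\<close> \<open>\<otimes>\<close> 1)
  \<open>\<Phi>\<close> times 1 \<open>\<otimes>\<close> \<open>\<Phi>\<close>. Under the integrand F
  the antipode identities consume every pair of factors that comes from a coproduct, and the counit
  reduces the associators involved to 1. What remains is b times the intertwiner on this side and the
  normalization sum over \<open>\<Psi>\<close> times b' on the other.
\<close>
lemma intertwiner_right:
  assumes T: "quasi_antipode T a b" and T': "quasi_antipode T' a' b'"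
    and norm: "contract3 (\<lambda>x y z. x * b * T y * a * z) \<Psi> = 1"
  shows "b * intertwiner T a T' b' = b'"
proof -
  note anti = quasi_antipodeD(2,3)[OF T] quasi_antipodeD(2,3)[OF T'] mult.assoc
  note lin = lins klin_comp[OF quasi_antipodeD(1)[OF T]] klin_comp[OF quasi_antipodeD(1)[OF T']]
  define F where "F x y z t = x * b * T y * a * z * b' * T' t" for x y z t
  have F: "quadrilin F" unfolding F_def by (intro lin)
  note linF = lin quadrilin_comp[OF F]
  have "contract3 (\<lambda>x y z. contract2 (\<lambda>x1 x2. contract3 (\<lambda>x' y' z'. contract2 (\<lambda>z1 z2.
        F (k * (x1 * x')) (l * (x2 * y')) (m * (y * z1)) (z * z2)) (\<Delta> z')) \<Phi>) (\<Delta> x)) \<Phi> =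
      contract3 (\<lambda>x y z. contract3 (\<lambda>x' y' z'. contract2 (\<lambda>y1 y2. contract3 (\<lambda>x'' y'' z''.
        F (k * (x * x')) (l * (y * y1 * x'')) (m * (z * y2 * y'')) (z' * z'')) \<Phi>) (\<Delta> y')) \<Phi>) \<Phi>"
    for k l m
    by (rule pentagon_contract[of "\<lambda>A B C D. F (k * A) (l * B) (m * C) D"]) (intro linF)
  moreover have "contract3 (\<lambda>x y z. contract2 (\<lambda>x1 x2. contract3 (\<lambda>x' y' z'. contract2 (\<lambda>z1 z2.
        F (k * (x1 * x')) (l * (x2 * y')) (m * (y * z1)) (z * z2)) (\<Delta> z')) \<Phi>) (\<Delta> x)) \<Phi> =
      k * b * T l * a * m * b'" for k l m
  proof -
    have "contract2 (\<lambda>z1 z2. F (k * (x1 * x')) (l * (x2 * y')) (m * (y * z1)) (z * z2)) (\<Delta> z') =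
        \<epsilon> z' *s (k * x1 * x' * b * T (l * x2 * y') * a * m * y * b' * T' z)" for x1 x2 x' y' z' y z
      using quasi_antipode_right[OF T', of
          "\<lambda>v. k * x1 * x' * b * T (l * x2 * y') * a * m * y * v * T' z" z']
      by (simp add: F_def anti lin)
    then have "contract3 (\<lambda>x' y' z'. contract2 (\<lambda>z1 z2.
        F (k * (x1 * x')) (l * (x2 * y')) (m * (y * z1)) (z * z2)) (\<Delta> z')) \<Phi> =
        k * x1 * 1 * b * T (l * x2 * 1) * a * m * y * b' * T' z" for x1 x2 y z
      by (simp only:) (rule counit_assoc_right, intro lin)
    moreover have "contract2 (\<lambda>x1 x2. k * x1 * 1 * b * T (l * x2 * 1) * a * m * y * b' * T' z) (\<Delta> x) =
        \<epsilon> x *s (k * b * T l * a * m * y * b' * T' z)" for x y z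
      using quasi_antipode_right[OF T, of "\<lambda>v. k * v * T l * a * m * y * b' * T' z" x]
      by (simp add: anti lin)
    moreover have "contract3 (\<lambda>x y z. \<epsilon> x *s (k * b * T l * a * m * y * b' * T' z)) \<Phi> =
        k * b * T l * a * m * 1 * b' * T' 1"
      by (rule counit_assoc_left) (intro lin)
    ultimately show ?thesis by (simp add: anti)
  qed
  moreover have "contract3 (\<lambda>k l m. k * b * T l * a * m * b') \<Psi> = b'"
    using klin_of_contract3[of "\<lambda>v. v * b'" "\<lambda>x y z. x * b * T y * a * z" \<Psi>] norm by (simp add: lin)
  moreover have "contract3 (\<lambda>k l m. contract3 (\<lambda>x y z. contract3 (\<lambda>x' y' z'. contract2 (\<lambda>y1 y2.
        contract3 (\<lambda>x'' y'' z''. F (k * (x * x')) (l * (y * y1 * x'')) (m * (z * y2 * y'')) (z' * z''))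
        \<Phi>) (\<Delta> y')) \<Phi>) \<Phi>) \<Psi> = b * intertwiner T a T' b'"
  proof -
    have "contract3 (\<lambda>k l m. contract3 (\<lambda>x y z. contract3 (\<lambda>x' y' z'. contract2 (\<lambda>y1 y2.
        contract3 (\<lambda>x'' y'' z''. F (k * x * x') (l * y * (y1 * x'')) (m * z * (y2 * y'')) (z' * z''))
        \<Phi>) (\<Delta> y')) \<Phi>) \<Phi>) \<Psi> =
      contract3 (\<lambda>x' y' z'. contract2 (\<lambda>y1 y2.
        contract3 (\<lambda>x'' y'' z''. F (1 * x') (1 * (y1 * x'')) (1 * (y2 * y'')) (z' * z''))
        \<Phi>) (\<Delta> y')) \<Phi>"
      by (rule contract_assoc_cancel(2)[of "\<lambda>x y z. contract3 (\<lambda>x' y' z'. contract2 (\<lambda>y1 y2.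
          contract3 (\<lambda>x'' y'' z''. F (x * x') (y * (y1 * x'')) (z * (y2 * y'')) (z' * z''))
          \<Phi>) (\<Delta> y')) \<Phi>"]) (intro linF)
    also have "\<dots> = contract3 (\<lambda>x' y' z'. \<epsilon> y' *s contract3 (\<lambda>x'' y'' z''.
        x' * b * T x'' * a * y'' * b' * T' (z' * z'')) \<Phi>) \<Phi>"
    proof -
      have "contract2 (\<lambda>y1 y2. contract3 (\<lambda>x'' y'' z''.
          F (1 * x') (1 * (y1 * x'')) (1 * (y2 * y'')) (z' * z'')) \<Phi>) (\<Delta> y') =
        \<epsilon> y' *s contract3 (\<lambda>x'' y'' z''. x' * b * T x'' * a * y'' * b' * T' (z' * z'')) \<Phi>" for x' y' z'
        using quasi_antipode_left[OF T, of "\<lambda>v. contract3 (\<lambda>x'' y'' z''.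
            x' * b * T x'' * v * y'' * b' * T' (z' * z'')) \<Phi>" y']
        by (simp add: F_def anti lin)
      then show ?thesis by simp
    qed
    also have "\<dots> = contract3 (\<lambda>x'' y'' z''. 1 * b * T x'' * a * y'' * b' * T' (1 * z'')) \<Phi>"
      by (rule counit_assoc_mid) (intro lin)
    also have "\<dots> = b * intertwiner T a T' b'"
      unfolding intertwiner_def
      by (subst klin_of_contract3[of "\<lambda>v. b * v"], intro lin, simp add: mult.assoc)
    finally show ?thesis by (simp only: mult.assoc)
  qed
  ultimately show ?thesis by simp
qed

text \<open>
  The mirror image of the previous argument: here the last factor 1 \<open>\<otimes>\<close>
  \<open>\<Phi>\<close> of the pentagon is moved to the other side.
\<close>
lemma intertwiner_left:
  assumes T: "quasi_antipode T a b" and T': "quasi_antipode T' a' b'"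
    and norm: "contract3 (\<lambda>x y z. x * b * T y * a * z) \<Psi> = 1"
  shows "intertwiner T' a' T b * a = a'"
proof -
  note anti = quasi_antipodeD(2,3)[OF T] quasi_antipodeD(2,3)[OF T'] mult.assoc
  note lin = lins klin_comp[OF quasi_antipodeD(1)[OF T]] klin_comp[OF quasi_antipodeD(1)[OF T']]
  define F where "F x y z t = T' x * a' * y * b * T z * a * t" for x y z t
  have F: "quadrilin F" unfolding F_def by (intro lin)
  note linF = lin quadrilin_comp[OF F]
  have "contract3 (\<lambda>x y z. contract2 (\<lambda>x1 x2. contract3 (\<lambda>x' y' z'. contract2 (\<lambda>z1 z2.
        contract3 (\<lambda>k l m. F (x1 * x') (x2 * y' * k) (y * z1 * l) (z * z2 * m)) \<Psi>)
        (\<Delta> z')) \<Phi>) (\<Delta> x)) \<Phi> =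
      contract3 (\<lambda>x y z. contract3 (\<lambda>x' y' z'. contract2 (\<lambda>y1 y2. contract3 (\<lambda>x'' y'' z''.
        contract3 (\<lambda>k l m. F (x * x') (y * y1 * x'' * k) (z * y2 * y'' * l) (z' * z'' * m)) \<Psi>)
        \<Phi>) (\<Delta> y')) \<Phi>) \<Phi>"
    by (rule pentagon_contract[of "\<lambda>A B C D. contract3 (\<lambda>k l m. F A (B * k) (C * l) (D * m)) \<Psi>"])
      (intro linF)
  moreover have "contract3 (\<lambda>x y z. contract2 (\<lambda>x1 x2. contract3 (\<lambda>x' y' z'. contract2 (\<lambda>z1 z2.
        contract3 (\<lambda>k l m. F (x1 * x') (x2 * y' * k) (y * z1 * l) (z * z2 * m)) \<Psi>)
        (\<Delta> z')) \<Phi>) (\<Delta> x)) \<Phi> = a'"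
  proof -
    have "contract2 (\<lambda>x1 x2. contract3 (\<lambda>x' y' z'. contract2 (\<lambda>z1 z2.
          contract3 (\<lambda>k l m. F (x1 * x') (x2 * y' * k) (y * z1 * l) (z * z2 * m)) \<Psi>)
          (\<Delta> z')) \<Phi>) (\<Delta> x) =
        \<epsilon> x *s contract3 (\<lambda>x' y' z'. contract2 (\<lambda>z1 z2. contract3 (\<lambda>k l m.
          T' x' * a' * y' * k * b * T (y * z1 * l) * a * (z * z2 * m)) \<Psi>) (\<Delta> z')) \<Phi>" for x y z
      using quasi_antipode_left[OF T', of "\<lambda>v. contract3 (\<lambda>x' y' z'. contract2 (\<lambda>z1 z2.
          contract3 (\<lambda>k l m. T' x' * v * y' * k * b * T (y * z1 * l) * a * (z * z2 * m)) \<Psi>)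
          (\<Delta> z')) \<Phi>" x]
      by (simp add: F_def anti lin)
    moreover have "contract3 (\<lambda>x y z. \<epsilon> x *s contract3 (\<lambda>x' y' z'. contract2 (\<lambda>z1 z2.
          contract3 (\<lambda>k l m. T' x' * a' * y' * k * b * T (y * z1 * l) * a * (z * z2 * m)) \<Psi>)
          (\<Delta> z')) \<Phi>) \<Phi> =
        contract3 (\<lambda>x' y' z'. contract2 (\<lambda>z1 z2. contract3 (\<lambda>k l m.
          T' x' * a' * y' * k * b * T (1 * z1 * l) * a * (1 * z2 * m)) \<Psi>) (\<Delta> z')) \<Phi>"
      by (rule counit_assoc_left) (intro lin)
    moreover have "contract2 (\<lambda>z1 z2. contract3 (\<lambda>k l m.
          T' x' * a' * y' * k * b * T (1 * z1 * l) * a * (1 * z2 * m)) \<Psi>) (\<Delta> z') =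
        \<epsilon> z' *s contract3 (\<lambda>k l m. T' x' * a' * y' * k * b * T l * a * m) \<Psi>" for x' y' z'
      using quasi_antipode_left[OF T, of "\<lambda>v. contract3 (\<lambda>k l m.
          T' x' * a' * y' * k * b * T l * v * m) \<Psi>" z']
      by (simp add: anti lin)
    moreover have "contract3 (\<lambda>x' y' z'. \<epsilon> z' *s
          contract3 (\<lambda>k l m. T' x' * a' * y' * k * b * T l * a * m) \<Psi>) \<Phi> =
        contract3 (\<lambda>k l m. T' 1 * a' * 1 * k * b * T l * a * m) \<Psi>"
      by (rule counit_assoc_right) (intro lin)
    moreover have "contract3 (\<lambda>k l m. T' 1 * a' * 1 * k * b * T l * a * m) \<Psi> = a'"
      using klin_of_contract3[of "\<lambda>v. a' * v" "\<lambda>x y z. x * b * T y * a * z" \<Psi>] norm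
      by (simp add: lin anti)
    ultimately show ?thesis by simp
  qed
  moreover have "contract3 (\<lambda>x y z. contract3 (\<lambda>x' y' z'. contract2 (\<lambda>y1 y2. contract3 (\<lambda>x'' y'' z''.
        contract3 (\<lambda>k l m. F (x * x') (y * y1 * x'' * k) (z * y2 * y'' * l) (z' * z'' * m)) \<Psi>)
        \<Phi>) (\<Delta> y')) \<Phi>) \<Phi> = intertwiner T' a' T b * a"
  proof -
    have "contract3 (\<lambda>x'' y'' z'' . contract3 (\<lambda>k l m.
        F (x * x') (y * y1 * x'' * k) (z * y2 * y'' * l) (z' * z'' * m)) \<Psi>) \<Phi> =
        F (x * x') (y * y1) (z * y2) z'" for x y z x' z' y1 y2
      using contract_assoc_cancel(1)[of "\<lambda>A B C. F (x * x') (y * y1 * A) (z * y2 * B) (z' * C)"]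
      by (simp add: mult.assoc linF)
    moreover have "contract2 (\<lambda>y1 y2. F (x * x') (y * y1) (z * y2) z') (\<Delta> y') =
        \<epsilon> y' *s (T' (x * x') * a' * y * b * T z * a * z')" for x y z x' y' z'
      using quasi_antipode_right[OF T, of "\<lambda>v. T' (x * x') * a' * y * v * T z * a * z'" y']
      by (simp add: F_def anti lin)
    moreover have "contract3 (\<lambda>x' y' z'. \<epsilon> y' *s (T' (x * x') * a' * y * b * T z * a * z')) \<Phi> =
        T' (x * 1) * a' * y * b * T z * a * 1" for x y z
      by (rule counit_assoc_mid) (intro lin)
    moreover have "contract3 (\<lambda>x y z. T' x * a' * y * b * T z * a) \<Phi> = intertwiner T' a' T b * a"
      unfolding intertwiner_def by (subst klin_of_contract3[of "\<lambda>v. v * a"], intro lin, rule refl)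
    ultimately show ?thesis by simp
  qed
  ultimately show ?thesis by simp
qed

text \<open>
  The second intertwiner is moved through T' into the sum that defines the first one, where it turns b
  into b'; the result is the normalization sum of T'.
\<close>
lemma intertwiner_left_inverse:
  assumes T: "quasi_antipode T a b" and T': "quasi_antipode T' a' b'"
    and norm: "contract3 (\<lambda>x y z. x * b * T y * a * z) \<Psi> = 1"
    and norm': "contract3 (\<lambda>x y z. T' x * a' * y * b' * T' z) \<Phi> = 1"
  shows "intertwiner T' a' T b * intertwiner T a T' b' = 1"
proof -
  let ?w = "intertwiner T a T' b'"
  have "intertwiner T' a' T b * ?w = contract3 (\<lambda>x y z. T' x * a' * y * b * T z * ?w) \<Phi>"
    unfolding intertwiner_def[of T'] by (rule klin_of_contract3) (intro lins)
  also have "\<dots> = contract3 (\<lambda>x y z. T' x * a' * y * b' * T' z) \<Phi>"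
  proof -
    have "T' x * a' * y * b * T z * ?w = T' x * a' * y * (b * ?w) * T' z" for x y z
      by (simp only: mult.assoc intertwiner_commute[OF T T'])
    then show ?thesis by (simp only: intertwiner_right[OF T T' norm])
  qed
  finally show ?thesis by (simp only: norm')
qed

end

section \<open>Conjugation of the antipode into its inverse\<close>

lemma ring_inv_eqI:
  fixes u v :: "'a::ring_1"
  assumes "u * v = 1" "v * u = 1"
  shows "ring_inv u = v"
  unfolding ring_inv_def
proof (rule the_equality)
  fix w assume "u * w = 1 \<and> w * u = 1"
  then have "w = (v * u) * w" using assms by simp
  also have "\<dots> = v" using \<open>u * w = 1 \<and> w * u = 1\<close> by (simp add: mult.assoc)
  finally show "w = v" .
qed (use assms in simp)

lemma ring_unit_inv:
  assumes "ring_unit u"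
  shows "u * ring_inv u = 1" "ring_inv u * u = 1"
  using assms ring_inv_eqI[of u] unfolding ring_unit_def by auto

context quasi_hopf_algebra
begin

lemma klin_antipode: "klin S"
proof -
  interpret S: Vector_Spaces.linear scale scale S by (rule antipode_linear)
  show ?thesis by (simp add: klin_def S.add S.scale)
qed

lemma quasi_antipode_S: "quasi_antipode S \<alpha> \<beta>"
  unfolding quasi_antipode_def
  by (simp add: klin_antipode antipode_mult antipode_one antipode_left antipode_right)

lemma inv_antipode: "S (inv S x) = x" "inv S (S x) = x"
  using antipode_bij by (auto simp: bij_def surj_f_inv_f)

lemma inv_antipode_mult: "inv S (x * y) = inv S y * inv S x"
  by (metis antipode_mult inv_antipode)

lemma inv_antipode_one: "inv S 1 = 1"
  by (metis antipode_one inv_antipode(2))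

lemma klin_inv_antipode: "klin (inv S)"
  using klin_antipode unfolding klin_def by (metis inv_antipode)

text \<open>
  In each sum the relations with \<open>\<alpha>\<close> and \<open>\<beta>\<close> and the
  conjugation of S are substituted so that all inner factors u and t cancel. The terms that are left are
  the values of \<open>inv S\<close> at the terms of a normalization sum of S, multiplied by u on the left
  or by t on the right.
\<close>
lemma twisted_conjugation_formulas:
  assumes inv: "u * t = 1" "t * u = 1"
    and conj: "\<And>a. S a = u * inv S a * t"
    and alpha: "u * inv S \<alpha> = aR" and beta: "bR * u = inv S \<beta>"
  shows "contract3 (\<lambda>x y z. S (y * \<beta> * S z) * aR * x) \<Phi> = u"
    "contract3 (\<lambda>x y z. S z * aR * y * inv S \<beta> * inv S x) \<Psi> = u"
    "contract3 (\<lambda>x y z. z * bR * S (S x * \<alpha> * y)) \<Phi> = t"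
    "contract3 (\<lambda>x y z. inv S z * inv S \<alpha> * y * bR * S x) \<Psi> = t"
proof -
  note S' = inv_antipode inv_antipode_mult mult.assoc
  have tu: "t * (u * x) = x" for x by (simp add: inv mult.assoc[symmetric])
  have bR: "bR * (u * x) = inv S \<beta> * x" for x by (simp add: beta mult.assoc[symmetric])
  have \<Phi>: "inv S (contract3 (\<lambda>x y z. S x * \<alpha> * y * \<beta> * S z) \<Phi>) = 1"
    and \<Psi>: "inv S (contract3 (\<lambda>x y z. x * \<beta> * S y * \<alpha> * z) \<Psi>) = 1"
    by (simp_all add: antipode_assoc antipode_assoc_inv inv_antipode_one)
  note push = klin_of_contract3[OF klin_inv_antipode]
    klin_of_contract3[OF klin_mult_left[OF klin_id]] klin_of_contract3[OF klin_mult_right[OF klin_id]]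
  have "u = u * inv S (contract3 (\<lambda>x y z. S x * \<alpha> * y * \<beta> * S z) \<Phi>)"
    by (simp add: \<Phi>)
  also have "\<dots> = contract3 (\<lambda>x y z. S (y * \<beta> * S z) * aR * x) \<Phi>"
    unfolding push by (simp add: alpha[symmetric] conj[of "_ * _"] S' tu)
  finally show "contract3 (\<lambda>x y z. S (y * \<beta> * S z) * aR * x) \<Phi> = u" by simp
  have "u = u * inv S (contract3 (\<lambda>x y z. x * \<beta> * S y * \<alpha> * z) \<Psi>)"
    by (simp add: \<Psi>)
  also have "\<dots> = contract3 (\<lambda>x y z. S z * aR * y * inv S \<beta> * inv S x) \<Psi>"
    unfolding push by (simp add: alpha[symmetric] S') (simp add: conj mult.assoc tu)
  finally show "contract3 (\<lambda>x y z. S z * aR * y * inv S \<beta> * inv S x) \<Psi> = u" by simp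
  have "t = inv S (contract3 (\<lambda>x y z. S x * \<alpha> * y * \<beta> * S z) \<Phi>) * t"
    by (simp add: \<Phi>)
  also have "\<dots> = contract3 (\<lambda>x y z. z * bR * S (S x * \<alpha> * y)) \<Phi>"
    unfolding push by (simp add: conj[of "_ * _"] S' bR)
  finally show "contract3 (\<lambda>x y z. z * bR * S (S x * \<alpha> * y)) \<Phi> = t" by simp
  have "t = inv S (contract3 (\<lambda>x y z. x * \<beta> * S y * \<alpha> * z) \<Psi>) * t"
    by (simp add: \<Psi>)
  also have "\<dots> = contract3 (\<lambda>x y z. inv S z * inv S \<alpha> * y * bR * S x) \<Psi>"
    unfolding push by (simp add: S') (simp add: conj mult.assoc bR)
  finally show "contract3 (\<lambda>x y z. inv S z * inv S \<alpha> * y * bR * S x) \<Psi> = t" by simp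
qed

end

section \<open>The R-matrix\<close>

context quasitriangular_quasi_hopf_algebra
begin

abbreviation "Q \<equiv> tinv 2 R"

lemma rmatrix_closed: "R \<in> tpower 2" "Q \<in> tpower 2" and rmatrix_is_tinv: "is_tinv 2 R Q"
  using rmatrix_unit is_tinv_tinv[OF rmatrix_unit] by (auto simp: tunit_def is_tinv_def)

lemma contract_rmatrix_cancel:
  assumes "bilin F"
  shows "contract2 (\<lambda>x y. contract2 (\<lambda>x' y'. F (x * x') (y * y')) Q) R = F 1 1"
    "contract2 (\<lambda>x y. contract2 (\<lambda>x' y'. F (x' * x) (y' * y)) R) Q = F 1 1"
  using contract_is_tinv2[OF rmatrix_is_tinv rmatrix_closed(1) assms]
  by (auto simp: contract_swap22[of _ R Q])

lemma contract2_flip: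
  assumes "bilin F" "X \<in> tpower 2"
  shows "contract2 F (tmap 2 (\<lambda>xs. pure [xs ! 1, xs ! 0]) X) = contract2 (\<lambda>x y. F y x) X"
  unfolding contract_tsum by (subst tsum_tmap_pure[OF multilinear2[OF assms(1)] assms(2)]) simp_all

text \<open>
  The relation between R and the flipped coproduct, and the same relation multiplied by the inverse of
  R from both sides.
\<close>
lemma rmatrix_contract:
  assumes F: "bilin F"
  shows "contract2 (\<lambda>r r'. contract2 (\<lambda>p q. F (r * p) (r' * q)) (\<Delta> h)) R =
      contract2 (\<lambda>p q. contract2 (\<lambda>r r'. F (q * r) (p * r')) R) (\<Delta> h)"
    and "contract2 (\<lambda>p q. contract2 (\<lambda>k l. F (p * k) (q * l)) Q) (\<Delta> h) =
      contract2 (\<lambda>k l. contract2 (\<lambda>p q. F (k * q) (l * p)) (\<Delta> h)) Q"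
proof -
  note lin = lins bilin_comp[OF F]
  let ?D = "tmap 2 (\<lambda>xs. pure [xs ! 1, xs ! 0]) (\<Delta> h)"
  have D: "?D \<in> tpower 2"
    by (intro tmap_in_tpower[OF comult_closed] pure_formals) simp
  note mem = D rmatrix_closed comult_closed
  have flip: "contract2 G ?D = contract2 (\<lambda>p q. G q p) (\<Delta> h)" if "bilin G" for G
    by (rule contract2_flip[OF that comult_closed])
  have "contract2 (\<lambda>r r'. contract2 (\<lambda>p q. F (r * p) (r' * q)) (\<Delta> h)) R =
      contract2 F (?D \<odot>\<^bsub>2\<^esub> R)"
    by (simp only: rmatrix_comult contract2_tmult[OF F] mem)
  also have "\<dots> = contract2 (\<lambda>x y. contract2 (\<lambda>r r'. F (x * r) (y * r')) R) ?D"
    by (rule contract2_tmult[OF F]) (intro mem)+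
  also have "\<dots> = contract2 (\<lambda>p q. contract2 (\<lambda>r r'. F (q * r) (p * r')) R) (\<Delta> h)"
    by (rule flip) (intro lin)
  finally show "contract2 (\<lambda>r r'. contract2 (\<lambda>p q. F (r * p) (r' * q)) (\<Delta> h)) R =
      contract2 (\<lambda>p q. contract2 (\<lambda>r r'. F (q * r) (p * r')) R) (\<Delta> h)" .
  have "Q \<odot>\<^bsub>2\<^esub> ?D = Q \<odot>\<^bsub>2\<^esub> (?D \<odot>\<^bsub>2\<^esub> (R \<odot>\<^bsub>2\<^esub> Q))"
    using rmatrix_is_tinv by (simp add: is_tinv_def tmult_tone_right D del: One_nat_def)
  also have "\<dots> = Q \<odot>\<^bsub>2\<^esub> ((?D \<odot>\<^bsub>2\<^esub> R) \<odot>\<^bsub>2\<^esub> Q)"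
    by (simp only: tmult_assoc mem)
  also have "\<dots> = (Q \<odot>\<^bsub>2\<^esub> R) \<odot>\<^bsub>2\<^esub> (\<Delta> h \<odot>\<^bsub>2\<^esub> Q)"
    by (simp only: rmatrix_comult tmult_assoc mem tmult_in_tpower)
  also have "\<dots> = \<Delta> h \<odot>\<^bsub>2\<^esub> Q"
    using rmatrix_is_tinv by (simp add: is_tinv_def tmult_tone_left tmult_in_tpower mem)
  finally have "contract2 F (\<Delta> h \<odot>\<^bsub>2\<^esub> Q) = contract2 F (Q \<odot>\<^bsub>2\<^esub> ?D)" by simp
  then have "contract2 (\<lambda>p q. contract2 (\<lambda>k l. F (p * k) (q * l)) Q) (\<Delta> h) =
      contract2 (\<lambda>k l. contract2 (\<lambda>x y. F (k * x) (l * y)) ?D) Q"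
    by (simp only: contract2_tmult[OF F] mem)
  also have "\<dots> = contract2 (\<lambda>k l. contract2 (\<lambda>p q. F (k * q) (l * p)) (\<Delta> h)) Q"
    by (subst flip, intro lin, rule refl)
  finally show "contract2 (\<lambda>p q. contract2 (\<lambda>k l. F (p * k) (q * l)) Q) (\<Delta> h) =
      contract2 (\<lambda>k l. contract2 (\<lambda>p q. F (k * q) (l * p)) (\<Delta> h)) Q" .
qed

lemma hexagon_left_contract:
  assumes G: "trilin G"
  shows "contract2 (\<lambda>f f'. contract2 (\<lambda>f1 f2. G f1 f2 f') (\<Delta> f)) R =
    contract3 (\<lambda>a b c. contract2 (\<lambda>r r'. contract3 (\<lambda>a' b' c'. contract2 (\<lambda>s s'.
      contract3 (\<lambda>a'' b'' c''. G (b * r * a' * 1 * a'') (c * 1 * c' * s * b'')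
        (a * r' * b' * s' * c'')) \<Psi>) R) \<Phi>) R) \<Psi>"
proof -
  note lin = lins trilin_comp[OF G]
  have emb: "tmap 3 (\<lambda>xs. pure [xs ! 0, 1, xs ! 1]) R \<in> tpower 3"
      "tmap 3 (\<lambda>xs. pure [1, xs ! 0, xs ! 1]) R \<in> tpower 3"
    by (intro tmap_in_tpower[OF rmatrix_closed(1)] pure_formals; simp)+
  show ?thesis
    unfolding contract3_legs(1)[OF G rmatrix_closed(1), symmetric] hexagon_left tinv_perm(1)[OF assoc_unit]
    apply (subst contract3_tmult5[OF G tensor3_perm[OF assoc_closed(2)] emb(1)
          tensor3_perm[OF assoc_closed(1)] emb(2) assoc_closed(2)])
    apply (subst contract3_perm(1), intro lin, rule assoc_closed)
    apply (subst contract3_embed(2), intro lin, rule rmatrix_closed)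
    apply (subst contract3_perm(2), intro lin, rule assoc_closed)
    apply (subst contract3_embed(3), intro lin, rule rmatrix_closed)
    apply (rule refl)
    done
qed

lemma hexagon_right_contract:
  assumes G: "trilin G"
  shows "contract2 (\<lambda>f f'. contract2 (\<lambda>f1 f2. G f f1 f2) (\<Delta> f')) R =
    contract3 (\<lambda>a b c. contract2 (\<lambda>s s'. contract3 (\<lambda>a' b' c'. contract2 (\<lambda>e e'.
      contract3 (\<lambda>x y z. G (c * s * b' * e * x) (a * 1 * a' * e' * y)
        (b * s' * c' * 1 * z)) \<Phi>) R) \<Psi>) R) \<Phi>"
proof -
  note lin = lins trilin_comp[OF G]
  have emb: "tmap 3 (\<lambda>xs. pure [xs ! 0, 1, xs ! 1]) R \<in> tpower 3"
      "tmap 3 (\<lambda>xs. pure [xs ! 0, xs ! 1, 1]) R \<in> tpower 3"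
    by (intro tmap_in_tpower[OF rmatrix_closed(1)] pure_formals; simp)+
  show ?thesis
    unfolding contract3_legs(2)[OF G rmatrix_closed(1), symmetric] hexagon_right tinv_perm(2)[OF assoc_unit]
    apply (subst contract3_tmult5[OF G tensor3_perm[OF assoc_closed(1)] emb(1)
          tensor3_perm[OF assoc_closed(2)] emb(2) assoc_closed(1)])
    apply (subst contract3_perm(3), intro lin, rule assoc_closed)
    apply (subst contract3_embed(2), intro lin, rule rmatrix_closed)
    apply (subst contract3_perm(4), intro lin, rule assoc_closed)
    apply (subst contract3_embed(1), intro lin, rule rmatrix_closed)
    apply (rule refl)
    done
qed

text \<open>
  Applying the counit to the first leg of the left hexagon reduces all associators to 1 and leaves
  R = (1 \<open>\<otimes>\<close> \<open>\<rho>\<close>) R, where \<open>\<rho>\<close> is R with the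
  counit applied to its first leg. The integrand B contains the inverse of R, which cancels the right
  factor R.
\<close>
lemma counit_rmatrix_left:
  assumes L: "klin L"
  shows "contract2 (\<lambda>e e'. \<epsilon> e *s L e') R = L 1"
proof -
  define B where "B u v = contract2 (\<lambda>k l. \<epsilon> (u * k) *s L (v * l)) Q" for u v
  have B: "bilin B" unfolding B_def by (intro lins klin_comp[OF L])
  note lin = lins bilin_comp[OF B] klin_comp[OF L]
  have "L 1 = contract2 B R"
    unfolding B_def by (subst contract_rmatrix_cancel(1)[of "\<lambda>x y. \<epsilon> x *s L y"], intro lin, simp add: counit_one)
  also have "\<dots> = contract2 (\<lambda>f f'. contract2 (\<lambda>f1 f2. \<epsilon> f1 *s B f2 f') (\<Delta> f)) R"
    by (subst contract_counit_left, intro lin, rule refl)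
  also have "\<dots> = contract3 (\<lambda>a b c. contract2 (\<lambda>r r'. contract3 (\<lambda>a' b' c'. contract2 (\<lambda>s s'.
      contract3 (\<lambda>a'' b'' c''. \<epsilon> (b * r * a' * 1 * a'') *s B (c * 1 * c' * s * b'')
        (a * r' * b' * s' * c'')) \<Psi>) R) \<Phi>) R) \<Psi>"
    by (rule hexagon_left_contract[of "\<lambda>x y z. \<epsilon> x *s B y z"]) (intro lin)
  also have "\<dots> = contract3 (\<lambda>a b c. \<epsilon> b *s contract2 (\<lambda>r r'. \<epsilon> r *s contract3 (\<lambda>a' b' c'.
      \<epsilon> a' *s contract2 (\<lambda>s s'. contract3 (\<lambda>a'' b'' c''. \<epsilon> a'' *s B (c * 1 * c' * s * b'')
        (a * r' * b' * s' * c'')) \<Psi>) R) \<Phi>) R) \<Psi>"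
    by (simp only: counit_mult_scale counit_one scale_one contract2_scale contract3_scale)
  also have "\<dots> = contract2 (\<lambda>r r'. \<epsilon> r *s contract3 (\<lambda>a' b' c'.
      \<epsilon> a' *s contract2 (\<lambda>s s'. contract3 (\<lambda>a'' b'' c''. \<epsilon> a'' *s B (1 * 1 * c' * s * b'')
        (1 * r' * b' * s' * c'')) \<Psi>) R) \<Phi>) R"
    by (rule counit_assoc_inverse(2)) (intro lin)
  also have "\<dots> = contract2 (\<lambda>r r'. \<epsilon> r *s contract2 (\<lambda>s s'. contract3 (\<lambda>a'' b'' c''.
      \<epsilon> a'' *s B (1 * 1 * 1 * s * b'') (1 * r' * 1 * s' * c'')) \<Psi>) R) R"
    by (subst counit_assoc_left, intro lin, rule refl)
  also have "\<dots> = contract2 (\<lambda>r r'. \<epsilon> r *s contract2 (\<lambda>s s'.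
      B (1 * 1 * 1 * s * 1) (1 * r' * 1 * s' * 1)) R) R"
    by (subst counit_assoc_inverse(1), intro lin, rule refl)
  also have "\<dots> = contract2 (\<lambda>r r'. \<epsilon> r *s L r') R"
  proof -
    have "contract2 (\<lambda>s s'. B (1 * 1 * 1 * s * 1) (1 * r' * 1 * s' * 1)) R = L r'" for r'
      unfolding B_def using contract_rmatrix_cancel(1)[of "\<lambda>x y. \<epsilon> x *s L (r' * y)"]
      by (simp add: lin mult.assoc counit_one)
    then show ?thesis by (simp only:)
  qed
  finally show ?thesis by simp
qed

text \<open>
  The same argument with the counit on the third leg of the right hexagon.
\<close>
lemma counit_rmatrix_right:
  assumes L: "klin L"
  shows "contract2 (\<lambda>e e'. \<epsilon> e' *s L e) R = L 1"
proof -
  define B where "B u v = contract2 (\<lambda>k l. \<epsilon> (v * l) *s L (u * k)) Q" for u v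
  have B: "bilin B" unfolding B_def by (intro lins klin_comp[OF L])
  note lin = lins bilin_comp[OF B] klin_comp[OF L]
  have "L 1 = contract2 B R"
    unfolding B_def by (subst contract_rmatrix_cancel(1)[of "\<lambda>x y. \<epsilon> y *s L x"], intro lin, simp add: counit_one)
  also have "\<dots> = contract2 (\<lambda>f f'. contract2 (\<lambda>f1 f2. \<epsilon> f2 *s B f f1) (\<Delta> f')) R"
    by (subst contract_counit_right, intro lin, rule refl)
  also have "\<dots> = contract3 (\<lambda>a b c. contract2 (\<lambda>s s'. contract3 (\<lambda>a' b' c'. contract2 (\<lambda>e e'.
      contract3 (\<lambda>x y z. \<epsilon> (b * s' * c' * 1 * z) *s B (c * s * b' * e * x) (a * 1 * a' * e' * y))
      \<Phi>) R) \<Psi>) R) \<Phi>"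
    by (rule hexagon_right_contract[of "\<lambda>x y z. \<epsilon> z *s B x y"]) (intro lin)
  also have "\<dots> = contract3 (\<lambda>a b c. \<epsilon> b *s contract2 (\<lambda>s s'. \<epsilon> s' *s contract3 (\<lambda>a' b' c'.
      \<epsilon> c' *s contract2 (\<lambda>e e'. contract3 (\<lambda>x y z. \<epsilon> z *s B (c * s * b' * e * x) (a * 1 * a' * e' * y))
      \<Phi>) R) \<Psi>) R) \<Phi>"
    by (simp only: counit_mult_scale counit_one scale_one contract2_scale contract3_scale)
  also have "\<dots> = contract2 (\<lambda>s s'. \<epsilon> s' *s contract3 (\<lambda>a' b' c'.
      \<epsilon> c' *s contract2 (\<lambda>e e'. contract3 (\<lambda>x y z. \<epsilon> z *s B (1 * s * b' * e * x) (1 * 1 * a' * e' * y))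
      \<Phi>) R) \<Psi>) R"
    by (rule counit_assoc_mid) (intro lin)
  also have "\<dots> = contract2 (\<lambda>s s'. \<epsilon> s' *s contract2 (\<lambda>e e'. contract3 (\<lambda>x y z.
      \<epsilon> z *s B (1 * s * 1 * e * x) (1 * 1 * 1 * e' * y)) \<Phi>) R) R"
    by (subst counit_assoc_inverse(3), intro lin, rule refl)
  also have "\<dots> = contract2 (\<lambda>s s'. \<epsilon> s' *s contract2 (\<lambda>e e'.
      B (1 * s * 1 * e * 1) (1 * 1 * 1 * e' * 1)) R) R"
    by (subst counit_assoc_right, intro lin, rule refl)
  also have "\<dots> = contract2 (\<lambda>s s'. \<epsilon> s' *s L s) R"
  proof -
    have "contract2 (\<lambda>e e'. B (1 * s * 1 * e * 1) (1 * 1 * 1 * e' * 1)) R = L s" for s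
      unfolding B_def using contract_rmatrix_cancel(1)[of "\<lambda>x y. \<epsilon> y *s L (s * x)"]
      by (simp add: lin mult.assoc counit_one)
    then show ?thesis by (simp only:)
  qed
  finally show ?thesis by simp
qed

text \<open>
  This is the identity
  \[ (\Delta^T \otimes 1)R \cdot R_{12}\, \Phi\, R_{23}^{-1} = \Phi_{321}^{-1} \cdot (1 \otimes \Delta^T)R , \]
  which says that twisting by R takes \<open>\<Phi>\<close> to its inverse with reversed legs. The left
  hexagon, with its first two legs exchanged, expands the first factor. The last three of its five
  factors, followed by those of R and \<open>\<Phi>\<close>, are then the right hand side of the right hexagon and
  fold to the coproduct of the second leg of R. The remaining R-matrix moves across this coproduct,
  flips it and meets its inverse.
\<close>
lemma rmatrix_twists_assoc:
  assumes F: "trilin F"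
  shows "contract2 (\<lambda>f f'. contract2 (\<lambda>f1 f2. contract2 (\<lambda>e e'. contract3 (\<lambda>x y z. contract2 (\<lambda>k l.
      F (f2 * e * x) (f1 * e' * y * k) (f' * z * l)) Q) \<Phi>) R) (\<Delta> f)) R =
    contract3 (\<lambda>x y z. contract2 (\<lambda>f f'. contract2 (\<lambda>f1 f2. F (z * f) (y * f2) (x * f1))
      (\<Delta> f')) R) \<Psi>"
proof -
  note lin = lins trilin_comp[OF F]
  have "contract2 (\<lambda>f f'. contract2 (\<lambda>f1 f2. contract2 (\<lambda>e e'. contract3 (\<lambda>x y z. contract2 (\<lambda>k l.
      F (f2 * e * x) (f1 * e' * y * k) (f' * z * l)) Q) \<Phi>) R) (\<Delta> f)) R =
    contract3 (\<lambda>a b c. contract2 (\<lambda>r r'. contract3 (\<lambda>a' b' c'. contract2 (\<lambda>s s'.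
      contract3 (\<lambda>a'' b'' c''. contract2 (\<lambda>e e'. contract3 (\<lambda>x y z. contract2 (\<lambda>k l.
      F (c * 1 * c' * s * b'' * e * x) (b * r * a' * 1 * a'' * e' * y * k) (a * r' * b' * s' * c'' * z * l))
      Q) \<Phi>) R) \<Psi>) R) \<Phi>) R) \<Psi>"
    by (rule hexagon_left_contract[of "\<lambda>f1 f2 f'. contract2 (\<lambda>e e'. contract3 (\<lambda>x y z. contract2 (\<lambda>k l.
      F (f2 * e * x) (f1 * e' * y * k) (f' * z * l)) Q) \<Phi>) R"]) (intro lin)
  also have "\<dots> = contract3 (\<lambda>a b c. contract2 (\<lambda>r r'. contract2 (\<lambda>f f'. contract2 (\<lambda>g1 g2.
      contract2 (\<lambda>k l. F (c * f) (b * (r * g1) * k) (a * (r' * g2) * l)) Q) (\<Delta> f')) R) R) \<Psi>"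
  proof -
    have "contract2 (\<lambda>f f'. contract2 (\<lambda>g1 g2.
        contract2 (\<lambda>k l. F (c * f) (b * (r * g1) * k) (a * (r' * g2) * l)) Q) (\<Delta> f')) R =
      contract3 (\<lambda>a' b' c'. contract2 (\<lambda>s s'. contract3 (\<lambda>a'' b'' c''. contract2 (\<lambda>e e'.
        contract3 (\<lambda>x y z. contract2 (\<lambda>k l. F (c * (c' * s * b'' * e * x))
          (b * (r * (a' * 1 * a'' * e' * y)) * k) (a * (r' * (b' * s' * c'' * 1 * z)) * l)) Q)
        \<Phi>) R) \<Psi>) R) \<Phi>" for a b c r r'
      by (rule hexagon_right_contract[of
            "\<lambda>x y z. contract2 (\<lambda>k l. F (c * x) (b * (r * y) * k) (a * (r' * z) * l)) Q"]) (intro lin)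
    then show ?thesis by (simp add: mult.assoc)
  qed
  also have "\<dots> = contract3 (\<lambda>a b c. contract2 (\<lambda>f f'. contract2 (\<lambda>r r'. contract2 (\<lambda>g1 g2.
      contract2 (\<lambda>k l. F (c * f) (b * (r * g1) * k) (a * (r' * g2) * l)) Q) (\<Delta> f')) R) R) \<Psi>"
    by (subst contract_swap22) (rule refl)
  also have "\<dots> = contract3 (\<lambda>a b c. contract2 (\<lambda>f f'. contract2 (\<lambda>g1 g2. contract2 (\<lambda>r r'.
      contract2 (\<lambda>k l. F (c * f) (b * (g2 * r) * k) (a * (g1 * r') * l)) Q) R) (\<Delta> f')) R) \<Psi>"
  proof -
    have "contract2 (\<lambda>r r'. contract2 (\<lambda>g1 g2.
        contract2 (\<lambda>k l. F (c * f) (b * (r * g1) * k) (a * (r' * g2) * l)) Q) (\<Delta> f')) R =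
      contract2 (\<lambda>g1 g2. contract2 (\<lambda>r r'.
        contract2 (\<lambda>k l. F (c * f) (b * (g2 * r) * k) (a * (g1 * r') * l)) Q) R) (\<Delta> f')" for a b c f f'
      by (rule rmatrix_contract(1)[of
            "\<lambda>x y. contract2 (\<lambda>k l. F (c * f) (b * x * k) (a * y * l)) Q"]) (intro lin)
    then show ?thesis by simp
  qed
  also have "\<dots> = contract3 (\<lambda>a b c. contract2 (\<lambda>f f'. contract2 (\<lambda>g1 g2.
      F (c * f) (b * g2) (a * g1)) (\<Delta> f')) R) \<Psi>"
  proof -
    have "contract2 (\<lambda>r r'. contract2 (\<lambda>k l. F (c * f) (b * (g2 * r) * k) (a * (g1 * r') * l)) Q) R =
        F (c * f) (b * g2) (a * g1)" for a b c f g1 g2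
      using contract_rmatrix_cancel(1)[of "\<lambda>x y. F (c * f) (b * g2 * x) (a * g1 * y)"]
      by (simp add: mult.assoc lin)
    then show ?thesis by simp
  qed
  finally show ?thesis .
qed

section \<open>The inverse antipode for the same coproduct\<close>

text \<open>
  The elements that accompany \<open>inv S\<close> after twisting the co-opposite structure by the
  inverse of R; a twist by G changes \<open>\<alpha>\<close> by the inverse of G and \<open>\<beta>\<close>
  by G, so R itself occurs with \<open>\<alpha>\<close>.
\<close>
definition alpha_twist :: 'a where
  "alpha_twist = contract2 (\<lambda>x y. inv S x * inv S \<alpha> * y) R"

definition beta_twist :: 'a where
  "beta_twist = contract2 (\<lambda>x y. x * inv S \<beta> * inv S y) Q"

lemmas linS = lins klin_comp[OF klin_antipode] klin_comp[OF klin_inv_antipode]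

text \<open>
  Moving R, or its inverse, across the coproduct of h flips the latter. The flipped identities for
  \<open>inv S\<close> are the antipode identities of S, to which the anti-multiplicative map
  \<open>inv S\<close> is applied.
\<close>
lemma quasi_antipode_inv: "quasi_antipode (inv S) alpha_twist beta_twist"
proof -
  note S' = inv_antipode inv_antipode_mult mult.assoc
  have "contract2 (\<lambda>p q. inv S p * alpha_twist * q) (\<Delta> h) = \<epsilon> h *s alpha_twist" for h
  proof -
    have "contract2 (\<lambda>p q. inv S p * alpha_twist * q) (\<Delta> h) =
        contract2 (\<lambda>p q. contract2 (\<lambda>r r'. inv S (r * p) * inv S \<alpha> * (r' * q)) R) (\<Delta> h)"
      unfolding alpha_twist_def
      by (subst klin_of_contract2[of "\<lambda>v. inv S p * v * q" for p q], intro linS) (simp add: S')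
    also have "\<dots> = contract2 (\<lambda>r r'. contract2 (\<lambda>p q. inv S (r * p) * inv S \<alpha> * (r' * q)) (\<Delta> h)) R"
      by (rule contract_swap22)
    also have "\<dots> = contract2 (\<lambda>p q. contract2 (\<lambda>r r'. inv S (q * r) * inv S \<alpha> * (p * r')) R) (\<Delta> h)"
      by (rule rmatrix_contract(1)) (intro linS)
    also have "\<dots> = contract2 (\<lambda>r r'. contract2 (\<lambda>p q. inv S (q * r) * inv S \<alpha> * (p * r')) (\<Delta> h)) R"
      by (rule contract_swap22)
    also have "\<dots> = contract2 (\<lambda>r r'. \<epsilon> h *s (inv S r * inv S \<alpha> * r')) R"
    proof -
      have "contract2 (\<lambda>p q. inv S (q * r) * inv S \<alpha> * (p * r')) (\<Delta> h) =
          \<epsilon> h *s (inv S r * inv S \<alpha> * r')" for r r'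
        using quasi_antipode_left[OF quasi_antipode_S, of "\<lambda>v. inv S r * inv S v * r'" h]
        by (simp add: S' linS)
      then show ?thesis by simp
    qed
    finally show ?thesis by (simp add: contract2_scale alpha_twist_def)
  qed
  moreover have "contract2 (\<lambda>p q. p * beta_twist * inv S q) (\<Delta> h) = \<epsilon> h *s beta_twist" for h
  proof -
    have "contract2 (\<lambda>p q. p * beta_twist * inv S q) (\<Delta> h) =
        contract2 (\<lambda>p q. contract2 (\<lambda>k l. (p * k) * inv S \<beta> * inv S (q * l)) Q) (\<Delta> h)"
      unfolding beta_twist_def
      by (subst klin_of_contract2[of "\<lambda>v. p * v * inv S q" for p q], intro linS) (simp add: S')
    also have "\<dots> = contract2 (\<lambda>k l. contract2 (\<lambda>p q. (k * q) * inv S \<beta> * inv S (l * p)) (\<Delta> h)) Q"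
      by (rule rmatrix_contract(2)) (intro linS)
    also have "\<dots> = contract2 (\<lambda>k l. \<epsilon> h *s (k * inv S \<beta> * inv S l)) Q"
    proof -
      have "contract2 (\<lambda>p q. (k * q) * inv S \<beta> * inv S (l * p)) (\<Delta> h) =
          \<epsilon> h *s (k * inv S \<beta> * inv S l)" for k l
        using quasi_antipode_right[OF quasi_antipode_S, of "\<lambda>v. k * inv S v * inv S l" h]
        by (simp add: S' linS)
      then show ?thesis by simp
    qed
    finally show ?thesis by (simp add: contract2_scale beta_twist_def)
  qed
  ultimately show ?thesis
    unfolding quasi_antipode_def
    by (simp add: klin_inv_antipode inv_antipode_mult inv_antipode_one)
qed

text \<open>
  Applying S to the sum gives the value M 1 of the integrand F at \<open>R\<^sub>1\<^sub>2\<close>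
  \<open>\<Phi>\<close> times the inverse of \<open>R\<^sub>2\<^sub>3\<close>. In the identity for that
  product the antipode identities consume the coproducts of the legs of R, and the counit removes what
  is left of R. On the other side F turns \<open>\<Psi>\<close> into the second normalization sum of S.
\<close>
lemma inv_antipode_normalized:
  "contract3 (\<lambda>x y z. inv S x * alpha_twist * y * beta_twist * inv S z) \<Phi> = 1"
proof -
  note S' = inv_antipode inv_antipode_mult mult.assoc
  define F where "F x y z = z * \<beta> * S y * \<alpha> * x" for x y z
  have F: "trilin F" unfolding F_def by (intro linS)
  note lin = linS trilin_comp[OF F]
  \<comment> \<open>The outer R enters the sum only through its second leg f, once the counit has consumed the first one.\<close>
  define M where "M f = contract2 (\<lambda>e e'. contract3 (\<lambda>x y z. contract2 (\<lambda>k l.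
      F (e * x) (e' * y * k) (f * z * l)) Q) \<Phi>) R" for f
  have M: "klin M" unfolding M_def by (intro lin)
  have "contract2 (\<lambda>f f'. contract2 (\<lambda>f1 f2. contract2 (\<lambda>e e'. contract3 (\<lambda>x y z. contract2 (\<lambda>k l.
      F (f2 * e * x) (f1 * e' * y * k) (f' * z * l)) Q) \<Phi>) R) (\<Delta> f)) R = M 1"
  proof -
    have "contract2 (\<lambda>f1 f2. contract2 (\<lambda>e e'. contract3 (\<lambda>x y z. contract2 (\<lambda>k l.
        F (f2 * e * x) (f1 * e' * y * k) (f' * z * l)) Q) \<Phi>) R) (\<Delta> f) = \<epsilon> f *s M f'" for f f'
      using quasi_antipode_left[OF quasi_antipode_S, of "\<lambda>v. contract2 (\<lambda>e e'. contract3 (\<lambda>x y z.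
          contract2 (\<lambda>k l. f' * z * l * \<beta> * S (e' * y * k) * v * e * x) Q) \<Phi>) R" f]
      by (simp add: M_def F_def antipode_mult mult.assoc linS)
    then show ?thesis using counit_rmatrix_left[OF M] by simp
  qed
  moreover have "contract3 (\<lambda>x y z. contract2 (\<lambda>f f'. contract2 (\<lambda>f1 f2. F (z * f) (y * f2) (x * f1))
      (\<Delta> f')) R) \<Psi> = 1"
  proof -
    have "contract2 (\<lambda>f1 f2. F (z * f) (y * f2) (x * f1)) (\<Delta> f') =
        \<epsilon> f' *s (x * \<beta> * S y * \<alpha> * z * f)" for x y z f f'
      using quasi_antipode_right[OF quasi_antipode_S, of "\<lambda>v. x * v * S y * \<alpha> * z * f" f']
      by (simp add: F_def antipode_mult mult.assoc linS)
    moreover have "contract2 (\<lambda>f f'. \<epsilon> f' *s (x * \<beta> * S y * \<alpha> * z * f)) R =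
        x * \<beta> * S y * \<alpha> * z * 1" for x y z
      by (rule counit_rmatrix_right) (intro linS)
    ultimately show ?thesis by (simp add: antipode_assoc_inv)
  qed
  ultimately have M1: "M 1 = 1" using rmatrix_twists_assoc[OF F] by simp
  have "contract3 (\<lambda>x y z. inv S x * alpha_twist * y * beta_twist * inv S z) \<Phi> =
      contract3 (\<lambda>x y z. contract2 (\<lambda>e e'. contract2 (\<lambda>k l.
        inv S (F (e * x) (e' * y * k) (1 * z * l))) Q) R) \<Phi>"
  proof -
    have "inv S x * alpha_twist * y * beta_twist * inv S z = contract2 (\<lambda>e e'. contract2 (\<lambda>k l.
        inv S (F (e * x) (e' * y * k) (1 * z * l))) Q) R" for x y z
      unfolding alpha_twist_def beta_twist_def
      by (subst klin_of_contract2[of "\<lambda>v. inv S x * v * y * _ * inv S z"], intro linS,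
          subst klin_of_contract2[of "\<lambda>v. inv S x * _ * y * v * inv S z"], intro linS)
        (simp add: F_def S' antipode_mult)
    then show ?thesis by simp
  qed
  also have "\<dots> = contract2 (\<lambda>e e'. contract3 (\<lambda>x y z. contract2 (\<lambda>k l.
        inv S (F (e * x) (e' * y * k) (1 * z * l))) Q) \<Phi>) R"
    by (rule contract_swap23[symmetric])
  also have "\<dots> = inv S (M 1)"
    unfolding M_def
    by (simp only: klin_of_contract2[OF klin_inv_antipode] klin_of_contract3[OF klin_inv_antipode])
  finally show ?thesis by (simp only: M1 inv_antipode_one)
qed

section \<open>The element u\<close>

text \<open>
  The intertwiners u and v compare S with \<open>inv S\<close> in both directions. The normalization
  of \<open>inv S\<close> gives v u = 1, and since u v is central it follows that u v = 1. The relations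
  with the R-matrix arise by undoing the twist: a sum over R inside a sum over its inverse cancels.
\<close>
lemma drinfeld_element_exists:
  obtains u v where "u * v = 1" "v * u = 1" "\<And>a. S a * u = u * inv S a"
    "u * inv S \<alpha> = alpha_R S \<alpha> R" "beta_R S \<beta> R * u = inv S \<beta>"
proof -
  note S' = inv_antipode inv_antipode_mult mult.assoc
  define u where "u = intertwiner S \<alpha> (inv S) beta_twist"
  define v where "v = intertwiner (inv S) alpha_twist S \<beta>"
  have u: "S h * u = u * inv S h" for h
    unfolding u_def by (rule intertwiner_commute[OF quasi_antipode_S quasi_antipode_inv])
  have v: "inv S h * v = v * S h" for h
    unfolding v_def by (rule intertwiner_commute[OF quasi_antipode_inv quasi_antipode_S])
  have \<beta>u: "\<beta> * u = beta_twist"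
    unfolding u_def
    by (rule intertwiner_right[OF quasi_antipode_S quasi_antipode_inv antipode_assoc_inv])
  have v\<alpha>: "v * \<alpha> = alpha_twist"
    unfolding v_def
    by (rule intertwiner_left[OF quasi_antipode_S quasi_antipode_inv antipode_assoc_inv])
  have vu: "v * u = 1"
    unfolding u_def v_def
    by (rule intertwiner_left_inverse[OF quasi_antipode_S quasi_antipode_inv antipode_assoc_inv
          inv_antipode_normalized])
  have uv: "u * v = 1"
  proof -
    \<comment> \<open>Both u v S(S k) and S(S k) u v are equal to u k v, and the square of S is surjective.\<close>
    have central: "u * v * h = h * (u * v)" for h
    proof -
      have "u * v * S (S k) = S (S k) * (u * v)" for k
        using u[of "S k"] v[of "S k"] by (simp add: inv_antipode mult.assoc) (metis mult.assoc)
      from this[of "inv S (inv S h)"] show ?thesis by (simp add: inv_antipode)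
    qed
    have "u * v = v * (u * (u * v))" by (simp add: vu mult.assoc[symmetric])
    also have "\<dots> = v * (u * v * u)" by (simp only: central[of u])
    also have "\<dots> = 1" by (simp add: vu mult.assoc)
    finally show ?thesis .
  qed
  have \<alpha>: "u * alpha_twist = \<alpha>" using uv v\<alpha> by (metis mult.assoc mult_1_left)
  have "alpha_R S \<alpha> R = contract2 (\<lambda>k l. contract2 (\<lambda>e e'. u * inv S (e * k) * inv S \<alpha> * (e' * l)) R) Q"
  proof -
    have "S k * \<alpha> * l = contract2 (\<lambda>e e'. u * inv S (e * k) * inv S \<alpha> * (e' * l)) R" for k l
    proof -
      have "S k * \<alpha> * l = S k * (u * alpha_twist) * l"
        by (simp only: \<alpha>)
      also have "\<dots> = (S k * u) * alpha_twist * l"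
        by (simp only: mult.assoc)
      finally have "S k * \<alpha> * l = u * inv S k * alpha_twist * l"
        by (simp only: u)
      then show ?thesis
        unfolding alpha_twist_def
        by (subst (asm) klin_of_contract2[of "\<lambda>v. u * inv S k * v * l"], intro linS) (simp add: S')
    qed
    then have "(\<lambda>k l. S k * \<alpha> * l) =
        (\<lambda>k l. contract2 (\<lambda>e e'. u * inv S (e * k) * inv S \<alpha> * (e' * l)) R)"
      by (intro ext)
    then show ?thesis
      unfolding alpha_R_def by (rule arg_cong[of _ _ "\<lambda>F. contract2 F Q"])
  qed
  also have "\<dots> = u * inv S 1 * inv S \<alpha> * 1"
    by (rule contract_rmatrix_cancel(2)) (intro linS)
  finally have aR: "u * inv S \<alpha> = alpha_R S \<alpha> R" by (simp add: inv_antipode_one)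
  have "beta_R S \<beta> R * u = contract2 (\<lambda>e e'. contract2 (\<lambda>k l. (e * k) * inv S \<beta> * inv S (e' * l)) Q) R"
  proof -
    have "e * \<beta> * S e' * u = contract2 (\<lambda>k l. (e * k) * inv S \<beta> * inv S (e' * l)) Q" for e e'
    proof -
      have "e * \<beta> * S e' * u = e * beta_twist * inv S e'"
        by (simp only: \<beta>u[symmetric] u mult.assoc)
      then show ?thesis
        unfolding beta_twist_def
        by (subst (asm) klin_of_contract2[of "\<lambda>v. e * v * inv S e'"], intro linS) (simp add: S')
    qed
    then show ?thesis
      unfolding beta_R_def by (subst klin_of_contract2[of "\<lambda>v. v * u"], intro linS) simp
  qed
  also have "\<dots> = 1 * inv S \<beta> * inv S 1"
    by (rule contract_rmatrix_cancel(1)) (intro linS)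
  finally have bR: "beta_R S \<beta> R * u = inv S \<beta>" by (simp add: inv_antipode_one)
  from that uv vu u aR bR show ?thesis by blast
qed

end

theorem theorem5:
  fixes scale :: "'k::field \<Rightarrow> 'a::ring_1 \<Rightarrow> 'a"
    and \<Delta> :: "'a \<Rightarrow> ('a, 'k) formal set"
    and \<epsilon> :: "'a \<Rightarrow> 'k"
    and \<Phi> R :: "('a, 'k) formal set"
    and S :: "'a \<Rightarrow> 'a"
    and \<alpha> \<beta> :: 'a
  assumes "quasitriangular_quasi_hopf_algebra scale \<Delta> \<epsilon> \<Phi> S \<alpha> \<beta> R"
  shows
    "(\<exists>!u. ring_unit u \<and>
           (\<forall>a. S a = u * inv S a * ring_inv u) \<and>
           u * inv S \<alpha> = k_algebra.alpha_R scale S \<alpha> R \<and>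
           k_algebra.beta_R scale S \<beta> R * u = inv S \<beta>) \<and>
     (\<forall>u. ring_unit u \<longrightarrow>
           (\<forall>a. S a = u * inv S a * ring_inv u) = (\<forall>a. S (S a) = u * a * ring_inv u)) \<and>
     (\<forall>u. ring_unit u \<and>
           (\<forall>a. S a = u * inv S a * ring_inv u) \<and>
           u * inv S \<alpha> = k_algebra.alpha_R scale S \<alpha> R \<and>
           k_algebra.beta_R scale S \<beta> R * u = inv S \<beta> \<longrightarrow>
           u = k_algebra.contract3 scale
                 (\<lambda>x y z. S (y * \<beta> * S z) * k_algebra.alpha_R scale S \<alpha> R * x) \<Phi> \<and>
           u = k_algebra.contract3 scale
                 (\<lambda>x y z. S z * k_algebra.alpha_R scale S \<alpha> R * y * inv S \<beta> * inv S x)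
                 (k_algebra.tinv scale 3 \<Phi>) \<and>
           ring_inv u = k_algebra.contract3 scale
                 (\<lambda>x y z. z * k_algebra.beta_R scale S \<beta> R * S (S x * \<alpha> * y)) \<Phi> \<and>
           ring_inv u = k_algebra.contract3 scale
                 (\<lambda>x y z. inv S z * inv S \<alpha> * y * k_algebra.beta_R scale S \<beta> R * S x)
                 (k_algebra.tinv scale 3 \<Phi>))"
proof -
  interpret quasitriangular_quasi_hopf_algebra scale \<Delta> \<epsilon> \<Phi> S \<alpha> \<beta> R by (rule assms)
  let ?P = "\<lambda>u. ring_unit u \<and> (\<forall>a. S a = u * inv S a * ring_inv u) \<and>
    u * inv S \<alpha> = alpha_R S \<alpha> R \<and> beta_R S \<beta> R * u = inv S \<beta>"
  have formulas: "u = contract3 (\<lambda>x y z. S (y * \<beta> * S z) * alpha_R S \<alpha> R * x) \<Phi>"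
      "u = contract3 (\<lambda>x y z. S z * alpha_R S \<alpha> R * y * inv S \<beta> * inv S x) (tinv 3 \<Phi>)"
      "ring_inv u = contract3 (\<lambda>x y z. z * beta_R S \<beta> R * S (S x * \<alpha> * y)) \<Phi>"
      "ring_inv u = contract3 (\<lambda>x y z. inv S z * inv S \<alpha> * y * beta_R S \<beta> R * S x) (tinv 3 \<Phi>)"
    if "?P u" for u
    using that twisted_conjugation_formulas[of u "ring_inv u"] ring_unit_inv[of u] by auto
  obtain u v where uv: "u * v = 1" "v * u = 1" and u: "\<And>a. S a * u = u * inv S a"
      "u * inv S \<alpha> = alpha_R S \<alpha> R" "beta_R S \<beta> R * u = inv S \<beta>"
    by (rule drinfeld_element_exists) blast
  have "S a = u * inv S a * v" for a
    using u(1)[of a] uv(1) by (metis mult.assoc mult_1_right)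
  with uv u have "?P u" by (auto simp: ring_unit_def ring_inv_eqI[OF uv])
  then have "\<exists>!u. ?P u"
  proof (rule ex1I)
    show "w = u" if "?P w" for w
      using formulas(1)[OF that] formulas(1)[OF \<open>?P u\<close>] by simp
  qed
  moreover have "(\<forall>a. S a = u * inv S a * ring_inv u) = (\<forall>a. S (S a) = u * a * ring_inv u)" for u
    by (metis inv_antipode)
  ultimately show ?thesis using formulas by blast
qed

end
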